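(* Let $\mathcal{U}$ be the $\alpha$-hypercircle associated to a unit $u(t)\in\mathbb{L}(t)$. Then the following statements are equivalent: 1. $\mathcal{U}$ is a line. 2. $\mathcal{U}$ is associated to a polynomial unit. 3. The root of the denominator of every non-polynomial unit generating $\mathcal{U}$ belongs to $\mathbb{K}$. 4. $\mathcal{U}$ is polynomially parametrizable (over $\mathbb{F}$). 5. $\mathcal{U}$ has one and only one branch (over $\mathbb{F}$) at infinity. 6. $\mathcal{U}$ is polynomially parametrizable over $\mathbb{K}$. 7. $\mathcal{U}$ has one and only one branch (over $\mathbb{K}$) at infinity.
   Context: $\mathbb{K}$ is a field of characteristic zero, $\mathbb{L}=\mathbb{K}(\alpha)$ is a finite algebraic extension of $\mathbb{K}$ of degree $n$ with primitive element $\alpha$, and $\mathbb{F}$ is the algebraic closure of $\mathbb{K}$. A unit of $\mathbb{L}(t)$ (under composition) is a rational function $u(t)=\frac{at+b}{ct+d}$ with $a,b,c,d\in\mathbb{L}$, $ad-bc\neq 0$; it is a polynomial unit if $c=0$, i.e. if it can be written as $at+b$ with $a,b\in\mathbb{L}$, $a\neq 0$. Every unit $u(t)\in\mathbb{L}(t)$ is written uniquely as $u(t)=\sum_{i=0}^{n-1}\phi_i(t)\alpha^i$ with $\phi_i(t)\in\mathbb{K}(t)$, and the $\alpha$-hypercircle generated by (or associated to) $u(t)$ is the rational curve $\mathcal{U}\subseteq\mathbb{F}^n$ parametrized by $\phi(t)=(\phi_0(t),\ldots,\phi_{n-1}(t))$ (the Zariski closure in $\mathbb{F}^n$ of the image of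 $\phi$). Different units may generate the same hypercircle. For a field $\mathbb{S}$ equal to $\mathbb{K}$ or $\mathbb{F}$: a curve is polynomially parametrizable over $\mathbb{S}$ if it has a parametrization whose components are polynomials in $\mathbb{S}[t]$; a branch over $\mathbb{S}$ at infinity of $\mathcal{U}$ is a branch, given by a local power series parametrization with coefficients in $\mathbb{S}$, of the projective closure of $\mathcal{U}$ centered at a point of the hyperplane at infinity. *)

theory Defs
  imports
    "HOL-Algebra.Algebraic_Closure_Type"
    "HOL-Algebra.Generated_Fields"
    "HOL-Algebra.Embedded_Algebras"
    "HOL-Library.Poly_Mapping"
    "HOL-Computational_Algebra.Computational_Algebra"
    "Jordan_Normal_Form.Matrix"
begin

text \<open>
  The algebraic closure $F$ of $K$ is a type \<open>'f\<close>, and $K$ and $L = K(\alpha)$ are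
  subsets of it.  The field-theoretic notions of HOL-Algebra are applied to
  \<^const>\<open>ring_of_type_algebra\<close>, the type \<open>'f\<close> regarded as a ring record.  Points of $F^n$ are
  vectors in \<^term>\<open>carrier_vec n\<close>, with coordinates indexed from $0$ to $n - 1$.
\<close>

definition is_algebraic_closure_of :: "'f::{alg_closed_field, field_char_0} set \<Rightarrow> bool" where
  "is_algebraic_closure_of K \<longleftrightarrow>
     subfield K (ring_of_type_algebra :: 'f ring) \<and>
     (\<forall>x. ring.algebraic (ring_of_type_algebra :: 'f ring) K x)"

definition adjoin :: "'f::field set \<Rightarrow> 'f \<Rightarrow> 'f set" where
  "adjoin K \<alpha> = generate_field ring_of_type_algebra (insert \<alpha> K)"

definition has_degree :: "'f::field set \<Rightarrow> 'f set \<Rightarrow> nat \<Rightarrow> bool" where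
  "has_degree K L n \<longleftrightarrow> ring.dimension ring_of_type_algebra n K L"


section \<open>Rational functions and units\<close>

definition polys_over :: "'f::field set \<Rightarrow> 'f poly set" where
  "polys_over S = {p. \<forall>i. Polynomial.coeff p i \<in> S}"

definition ratfuns_over :: "'f::field set \<Rightarrow> 'f poly fract set" where
  "ratfuns_over S = {Fract p q | p q. p \<in> polys_over S \<and> q \<in> polys_over S \<and> q \<noteq> 0}"

definition mobius :: "'f::field \<Rightarrow> 'f \<Rightarrow> 'f \<Rightarrow> 'f \<Rightarrow> 'f poly fract" where
  "mobius a b c d = Fract [:b, a:] [:d, c:]"

definition is_unit_over :: "'f::field set \<Rightarrow> 'f poly fract \<Rightarrow> bool" where
  "is_unit_over L u \<longleftrightarrow>
     (\<exists>a\<in>L. \<exists>b\<in>L. \<exists>c\<in>L. \<exists>d\<in>L. a * d - b * c \<noteq> 0 \<and> u = mobius a b c d)"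

definition is_polynomial_unit_over :: "'f::field set \<Rightarrow> 'f poly fract \<Rightarrow> bool" where
  "is_polynomial_unit_over L u \<longleftrightarrow> (\<exists>a\<in>L. \<exists>b\<in>L. a \<noteq> 0 \<and> u = Fract [:b, a:] 1)"

text \<open>\<open>ratfun_value f t v\<close>: the rational function \<open>f\<close> is defined at \<open>t\<close> and has value \<open>v\<close> there.\<close>

definition ratfun_value :: "'f::field poly fract \<Rightarrow> 'f \<Rightarrow> 'f \<Rightarrow> bool" where
  "ratfun_value f t v \<longleftrightarrow>
     (\<exists>p q. f = Fract p q \<and> poly q t \<noteq> 0 \<and> v = poly p t / poly q t)"

definition ratfun_image :: "nat \<Rightarrow> 'f::field poly fract vec \<Rightarrow> 'f vec set" where
  "ratfun_image n \<phi> = {x \<in> carrier_vec n. \<exists>t. \<forall>i<n. ratfun_value (\<phi> $ i) t (x $ i)}"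


section \<open>Zariski closures\<close>

text \<open>A multivariate polynomial maps exponent vectors (finitely supported maps from variable
  indices to exponents) to coefficients.\<close>

type_synonym 'a mpoly = "(nat \<Rightarrow>\<^sub>0 nat) \<Rightarrow>\<^sub>0 'a"

definition mpolys :: "nat \<Rightarrow> 'a::zero mpoly set" where
  "mpolys n = {P. \<forall>m \<in> Poly_Mapping.keys P. Poly_Mapping.keys m \<subseteq> {..<n}}"

definition homogeneous :: "'a::zero mpoly \<Rightarrow> bool" where
  "homogeneous P \<longleftrightarrow>
     (\<exists>d. \<forall>m \<in> Poly_Mapping.keys P. (\<Sum>i\<in>Poly_Mapping.keys m. Poly_Mapping.lookup m i) = d)"

text \<open>The map \<open>h\<close> embeds the coefficients into the ring in which \<open>P\<close> is evaluated.\<close>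

definition mpoly_eval :: "('a::zero \<Rightarrow> 'b::comm_semiring_1) \<Rightarrow> 'b vec \<Rightarrow> 'a mpoly \<Rightarrow> 'b" where
  "mpoly_eval h x P = (\<Sum>m\<in>Poly_Mapping.keys P. h (Poly_Mapping.lookup P m) *
     (\<Prod>i\<in>Poly_Mapping.keys m. (x $ i) ^ Poly_Mapping.lookup m i))"

definition zariski_closure :: "nat \<Rightarrow> 'f::field vec set \<Rightarrow> 'f vec set" where
  "zariski_closure n A = {x \<in> carrier_vec n.
     \<forall>P \<in> mpolys n. (\<forall>y\<in>A. mpoly_eval id y P = 0) \<longrightarrow> mpoly_eval id x P = 0}"

text \<open>The closure in $P^n(F)$ of the image of \<open>U\<close> under $x \mapsto (1 : x)$, given as the set of
  all homogeneous coordinate vectors of its points.  Coordinate $0$ is the homogenizing one, so the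
  hyperplane at infinity is $x_0 = 0$.\<close>

definition projective_closure :: "nat \<Rightarrow> 'f::field vec set \<Rightarrow> 'f vec set" where
  "projective_closure n U = {x \<in> carrier_vec (Suc n). x \<noteq> 0\<^sub>v (Suc n) \<and>
     (\<forall>P \<in> mpolys (Suc n). homogeneous P \<longrightarrow>
        (\<forall>y\<in>U. mpoly_eval id (vCons 1 y) P = 0) \<longrightarrow> mpoly_eval id x P = 0)}"


section \<open>Hypercircles\<close>

definition unit_components ::
    "'f::field set \<Rightarrow> 'f \<Rightarrow> nat \<Rightarrow> 'f poly fract \<Rightarrow> 'f poly fract vec" where
  "unit_components K \<alpha> n u = (THE \<phi>. \<phi> \<in> carrier_vec n \<and>
     (\<forall>i<n. \<phi> $ i \<in> ratfuns_over K) \<and> u = (\<Sum>i<n. \<phi> $ i * Fract [:\<alpha> ^ i:] 1))"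

definition hypercircle :: "'f::field set \<Rightarrow> 'f \<Rightarrow> nat \<Rightarrow> 'f poly fract \<Rightarrow> 'f vec set" where
  "hypercircle K \<alpha> n u = zariski_closure n (ratfun_image n (unit_components K \<alpha> n u))"

definition is_line :: "nat \<Rightarrow> 'f::field vec set \<Rightarrow> bool" where
  "is_line n U \<longleftrightarrow> (\<exists>p \<in> carrier_vec n. \<exists>v \<in> carrier_vec n.
     v \<noteq> 0\<^sub>v n \<and> U = {p + s \<cdot>\<^sub>v v | s. True})"

definition polynomially_parametrizable :: "'f::field set \<Rightarrow> nat \<Rightarrow> 'f vec set \<Rightarrow> bool" where
  "polynomially_parametrizable S n U \<longleftrightarrow> (\<exists>p \<in> carrier_vec n.
     (\<forall>i<n. p $ i \<in> polys_over S) \<and>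
     zariski_closure n (ratfun_image n (map_vec (\<lambda>q. Fract q 1) p)) = U)"


section \<open>Branches\<close>

definition fps_over :: "'f::field set \<Rightarrow> 'f fps set" where
  "fps_over S = {f. \<forall>k. fps_nth f k \<in> S}"

text \<open>
  A local parametrization over \<open>S\<close> of a projective set \<open>V\<close> is a point
  $(a_0 : \dots : a_n)$ of projective space over $S((x))$ that satisfies the homogeneous equations
  of \<open>V\<close> and is not a constant point.  Every such point has homogeneous coordinates in $S[[x]]$
  with some $a_i(0) \neq 0$, and only these are considered; the center is then
  $(a_0(0) : \dots : a_n(0))$.
\<close>

definition local_param :: "'f::field set \<Rightarrow> nat \<Rightarrow> 'f vec set \<Rightarrow> 'f fps vec \<Rightarrow> bool" where
  "local_param S n V a \<longleftrightarrow>
     a \<in> carrier_vec (Suc n) \<and>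
     (\<forall>i\<le>n. a $ i \<in> fps_over S) \<and>
     (\<exists>i\<le>n. fps_nth (a $ i) 0 \<noteq> 0) \<and>
     (\<forall>P \<in> mpolys (Suc n). homogeneous P \<longrightarrow>
        (\<forall>x\<in>V. mpoly_eval id x P = 0) \<longrightarrow> mpoly_eval fps_const a P = 0) \<and>
     \<not> (\<exists>\<rho>. \<exists>c \<in> carrier_vec (Suc n). a = \<rho> \<cdot>\<^sub>v map_vec fps_const c)"

text \<open>Equivalence is substitution of a series of order one.  The unit \<open>\<rho>\<close> accounts for the
  choice of homogeneous coordinates.\<close>

definition param_equiv :: "'f::field set \<Rightarrow> 'f fps vec \<Rightarrow> 'f fps vec \<Rightarrow> bool" where
  "param_equiv S a b \<longleftrightarrow>
     (\<exists>T \<in> fps_over S. \<exists>\<rho> \<in> fps_over S. fps_nth T 0 = 0 \<and> fps_nth T 1 \<noteq> 0 \<and>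
        fps_nth \<rho> 0 \<noteq> 0 \<and> b = \<rho> \<cdot>\<^sub>v map_vec (\<lambda>f. fps_compose f T) a)"

definition reducible_param :: "'f::field set \<Rightarrow> nat \<Rightarrow> 'f vec set \<Rightarrow> 'f fps vec \<Rightarrow> bool" where
  "reducible_param S n V a \<longleftrightarrow>
     (\<exists>b r. local_param S n V b \<and> r \<ge> 2 \<and>
        param_equiv S (map_vec (\<lambda>f. fps_compose f (fps_X ^ r)) b) a)"

text \<open>A branch is an equivalence class of irreducible local parametrizations.\<close>

definition branches_at_infinity :: "'f::field set \<Rightarrow> nat \<Rightarrow> 'f vec set \<Rightarrow> 'f fps vec set set" where
  "branches_at_infinity S n U =
     {a. local_param S n (projective_closure n U) a \<and>
         \<not> reducible_param S n (projective_closure n U) a \<and> fps_nth (a $ 0) 0 = 0}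
     // {(a, b). param_equiv S a b}"

end

theory Submission
  imports Defs
begin

text \<open>
  Write $L = K(\alpha)$ and let $\beta$ run over the conjugates of $\alpha$.  If $\varphi$ is the
  component vector of a unit $u$, then $\sum_i \varphi_i \beta^i$ is the conjugate $u^\sigma$, again
  a unit; so in the coordinate $\sum_i x_i \beta^i$ the hypercircle is parametrized by a Moebius map.
  If $u$ is a polynomial or has its pole in $K$, the components are visibly those of a line with a
  direction and a base point in $K^n$, and a line has exactly one branch at infinity.
  Otherwise $u$ has a pole $e$ which is moved by some $\sigma$, and the coordinates
  belonging to $\alpha$ and to $\sigma \alpha$ satisfy the equation of a hyperbola.  A polynomial
  parametrization would factor a nonzero constant into nonconstant polynomials; expansions at
  $e$ and at $\sigma e$ give two inequivalent branches over $F$; and at a center at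
  infinity one of the two coordinates vanishes, which is impossible for coordinates in $K$ because the
  powers of $\alpha$ (or of $\sigma \alpha$) are independent over $K$.
\<close>

no_notation fps_nth (infixl "$" 75)

section \<open>Subfields and conjugates\<close>

locale subfield_of_type =
  fixes S :: "'a::field set"
  assumes one_mem: "1 \<in> S"
    and diff_mem: "x \<in> S \<Longrightarrow> y \<in> S \<Longrightarrow> x - y \<in> S"
    and mult_mem: "x \<in> S \<Longrightarrow> y \<in> S \<Longrightarrow> x * y \<in> S"
    and inverse_mem: "x \<in> S \<Longrightarrow> inverse x \<in> S"
begin

lemma zero_mem: "0 \<in> S"
  using diff_mem[OF one_mem one_mem] by simp

lemma uminus_mem: "x \<in> S \<Longrightarrow> - x \<in> S"
  using diff_mem[OF zero_mem] by simp

lemma add_mem: "x \<in> S \<Longrightarrow> y \<in> S \<Longrightarrow> x + y \<in> S"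
  using diff_mem[OF _ uminus_mem] by fastforce

lemma divide_mem: "x \<in> S \<Longrightarrow> y \<in> S \<Longrightarrow> x / y \<in> S"
  by (simp add: divide_inverse mult_mem inverse_mem)

lemma sum_mem: "(\<And>i. i \<in> I \<Longrightarrow> f i \<in> S) \<Longrightarrow> sum f I \<in> S"
  by (induction I rule: infinite_finite_induct) (auto intro: zero_mem add_mem)

lemma prod_mem: "(\<And>i. i \<in> I \<Longrightarrow> f i \<in> S) \<Longrightarrow> prod f I \<in> S"
  by (induction I rule: infinite_finite_induct) (auto intro: one_mem mult_mem)

lemma power_mem: "x \<in> S \<Longrightarrow> x ^ k \<in> S"
  by (induction k) (auto intro: one_mem mult_mem)

lemma of_nat_mem: "of_nat k \<in> S"
  by (induction k) (auto intro: one_mem zero_mem add_mem)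

lemmas mem = zero_mem one_mem diff_mem uminus_mem add_mem mult_mem inverse_mem divide_mem
  sum_mem prod_mem power_mem of_nat_mem

lemma polys_overI: "(\<And>i. Polynomial.coeff p i \<in> S) \<Longrightarrow> p \<in> polys_over S"
  by (simp add: polys_over_def)

lemma coeff_mem: "p \<in> polys_over S \<Longrightarrow> Polynomial.coeff p i \<in> S"
  by (simp add: polys_over_def)

lemma pCons_polys: "pCons c p \<in> polys_over S \<longleftrightarrow> c \<in> S \<and> p \<in> polys_over S"
proof
  assume *: "pCons c p \<in> polys_over S"
  show "c \<in> S \<and> p \<in> polys_over S"
    using coeff_mem[OF *, of 0] coeff_mem[OF *, of "Suc _"] by (auto intro: polys_overI)
next
  assume "c \<in> S \<and> p \<in> polys_over S"
  then show "pCons c p \<in> polys_over S"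
    by (auto simp: polys_over_def coeff_pCons split: nat.split)
qed

lemma zero_polys: "0 \<in> polys_over S"
  by (simp add: polys_over_def zero_mem)

lemma one_polys: "1 \<in> polys_over S"
  by (simp add: one_pCons pCons_polys zero_polys one_mem)

lemma add_polys: "p \<in> polys_over S \<Longrightarrow> q \<in> polys_over S \<Longrightarrow> p + q \<in> polys_over S"
  by (simp add: polys_over_def add_mem)

lemma diff_polys: "p \<in> polys_over S \<Longrightarrow> q \<in> polys_over S \<Longrightarrow> p - q \<in> polys_over S"
  by (simp add: polys_over_def diff_mem)

lemma mult_polys: "p \<in> polys_over S \<Longrightarrow> q \<in> polys_over S \<Longrightarrow> p * q \<in> polys_over S"
  by (simp add: polys_over_def Polynomial.coeff_mult mem)

lemma sum_polys: "(\<And>i. i \<in> I \<Longrightarrow> f i \<in> polys_over S) \<Longrightarrow> sum f I \<in> polys_over S"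
  by (induction I rule: infinite_finite_induct) (auto intro: zero_polys add_polys)

lemma monom_polys: "c \<in> S \<Longrightarrow> Polynomial.monom c k \<in> polys_over S"
  by (simp add: polys_over_def zero_mem)

lemma pderiv_polys: "p \<in> polys_over S \<Longrightarrow> pderiv p \<in> polys_over S"
  by (simp add: polys_over_def coeff_pderiv mem del: of_nat_Suc)

lemmas polys = zero_polys one_polys add_polys diff_polys mult_polys sum_polys
  monom_polys pderiv_polys

lemma polys_division:
  assumes "p \<in> polys_over S" "q \<in> polys_over S" "q \<noteq> 0"
  obtains k r where "k \<in> polys_over S" "r \<in> polys_over S" "p = q * k + r"
    "r = 0 \<or> Polynomial.degree r < Polynomial.degree q"
proof -
  have "\<exists>k\<in>polys_over S. \<exists>r\<in>polys_over S. p = q * k + r \<and>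
      (r = 0 \<or> Polynomial.degree r < Polynomial.degree q)"
    using assms(1)
  proof (induction "Polynomial.degree p" arbitrary: p rule: less_induct)
    case less
    show ?case
    proof (cases "p = 0 \<or> Polynomial.degree p < Polynomial.degree q")
      case True
      then show ?thesis
        using less.prems by (intro bexI[of _ 0] bexI[of _ p]) (auto intro: polys)
    next
      case False
      define c where "c = Polynomial.monom (lead_coeff p / lead_coeff q)
        (Polynomial.degree p - Polynomial.degree q)"
      have c: "c \<in> polys_over S"
        unfolding c_def using less.prems assms by (intro monom_polys divide_mem coeff_mem)
      have c0: "c \<noteq> 0"
        using False assms by (simp add: c_def)
      have deg: "Polynomial.degree (q * c) = Polynomial.degree p"
        using False assms c0 by (simp add: c_def degree_mult_eq Polynomial.degree_monom_eq)
      have "lead_coeff c = lead_coeff p / lead_coeff q"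
        using False assms by (simp add: c_def Polynomial.degree_monom_eq)
      then have lc: "lead_coeff (q * c) = lead_coeff p"
        using assms by (simp add: lead_coeff_mult)
      have "p - q * c = 0 \<or> Polynomial.degree (p - q * c) < Polynomial.degree p"
        using deg lc by (intro eq_zero_or_degree_less Polynomial.degree_diff_le) auto
      moreover have "p - q * c \<in> polys_over S"
        using less.prems c assms by (intro polys)
      ultimately obtain k r where kr: "k \<in> polys_over S" "r \<in> polys_over S" "p - q * c = q * k + r"
        "r = 0 \<or> Polynomial.degree r < Polynomial.degree q"
        using less.hyps zero_polys by fastforce
      show ?thesis
        using kr c by (intro bexI[of _ "k + c"] bexI[of _ r]) (auto intro: polys simp: algebra_simps)
    qed
  qed
  with that show ?thesis by blast
qed

end

interpretation UNIV_subfield: subfield_of_type UNIV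
  by standard auto

lemma ring_of_type_simps [simp]:
  "carrier ring_of_type_algebra = UNIV"
  "x \<otimes>\<^bsub>ring_of_type_algebra\<^esub> y = x * y"
  "x \<oplus>\<^bsub>ring_of_type_algebra\<^esub> y = x + y"
  "\<one>\<^bsub>ring_of_type_algebra\<^esub> = 1"
  "\<zero>\<^bsub>ring_of_type_algebra\<^esub> = 0"
  by (simp_all add: ring_of_type_algebra_def)

lemma ring_of_type_pow [simp]: "x [^]\<^bsub>ring_of_type_algebra\<^esub> (k::nat) = (x::'a::field) ^ k"
  by (induction k) (simp_all add: nat_pow_def mult.commute)

lemma ring_of_type_minus [simp]: "\<ominus>\<^bsub>ring_of_type_algebra\<^esub> x = - (x::'a::field)"
proof -
  interpret ring "ring_of_type_algebra :: 'a ring"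
    by (rule ring_from_type_algebra)
  show ?thesis
    by (rule minus_equality) auto
qed

lemma ring_of_type_inv [simp]:
  assumes "x \<noteq> 0" shows "inv\<^bsub>ring_of_type_algebra\<^esub> x = inverse (x::'a::field)"
proof -
  interpret cring "ring_of_type_algebra :: 'a ring"
    by (rule cring_from_type_algebra)
  show ?thesis
    using assms by (intro comm_inv_char) auto
qed

lemma subfield_imp_subfield_of_type:
  assumes "subfield S (ring_of_type_algebra :: 'a::field ring)"
  shows "subfield_of_type S"
proof
  note sr = subfieldE(1)[OF assms]
  show "1 \<in> S" using subringE(3)[OF sr] by simp
  show "x * y \<in> S" if "x \<in> S" "y \<in> S" for x y
    using subringE(6)[OF sr that] by simp
  show "x - y \<in> S" if "x \<in> S" "y \<in> S" for x y
    using subringE(7)[OF sr that(1) subringE(5)[OF sr that(2)]] by simp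
  show "inverse x \<in> S" if "x \<in> S" for x
  proof (cases "x = 0")
    case False
    then show ?thesis
      using ring.subfield_m_inv(1)[OF ring_from_type_algebra assms, of x] that by simp
  qed (use that in simp)
qed

lemma eval_ring_of_type:
  "ring.eval ring_of_type_algebra cs x = poly (Poly (rev cs)) (x::'a::field)"
proof (induction cs)
  case (Cons c cs)
  show ?case
    by (simp add: Cons Poly_append poly_monom ring.eval.simps[OF ring_from_type_algebra])
qed (simp add: ring.eval.simps[OF ring_from_type_algebra])

lemma dimension_power_basis:
  fixes K :: "'f::field set"
  assumes K: "subfield K (ring_of_type_algebra :: 'f ring)"
    and alg: "ring.algebraic (ring_of_type_algebra :: 'f ring) K \<alpha>"
    and dim: "has_degree K (adjoin K \<alpha>) n"
  shows "subfield (adjoin K \<alpha>) (ring_of_type_algebra :: 'f ring)"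
    and "adjoin K \<alpha> = {poly p \<alpha> | p. p \<in> polys_over K \<and> (p = 0 \<or> Polynomial.degree p < n)}"
    and "\<And>p. p \<in> polys_over K \<Longrightarrow> Polynomial.degree p < n \<Longrightarrow> poly p \<alpha> = 0 \<Longrightarrow> p = 0"
proof -
  let ?R = "ring_of_type_algebra :: 'f ring"
  interpret R: field ?R by (rule field_from_type_algebra)
  interpret S: subfield_of_type K by (rule subfield_imp_subfield_of_type[OF K])
  have alg': "((R.algebraic) over K) \<alpha>"
    using alg by (simp add: over_def)
  have car: "insert \<alpha> K \<subseteq> carrier ?R" by simp
  have "subfield (R.simple_extension K \<alpha>) ?R"
    using R.simple_extension_is_subfield[OF K _] alg' by simp
  then have "adjoin K \<alpha> \<subseteq> R.simple_extension K \<alpha>"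
    unfolding adjoin_def
    using R.generate_field_min_subfield1[OF car] R.simple_extension_incl[of K \<alpha>]
      R.simple_extension_mem[OF subfieldE(1)[OF K], of \<alpha>] by auto
  moreover have sub: "subfield (adjoin K \<alpha>) ?R"
    unfolding adjoin_def by (rule R.generate_field_is_subfield[OF car])
  moreover have "R.simple_extension K \<alpha> \<subseteq> adjoin K \<alpha>"
    by (rule R.simple_extension_subring_incl[OF subfieldE(1)[OF sub]])
      (auto simp: adjoin_def intro: generate_field.incl)
  ultimately have L: "adjoin K \<alpha> = R.simple_extension K \<alpha>"
    by blast
  show "subfield (adjoin K \<alpha>) ?R" by (fact sub)
  have "R.dimension n K (R.simple_extension K \<alpha>)"
    using dim by (simp add: has_degree_def L)
  then have n: "length (R.Irr K \<alpha>) - 1 = n"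
    using R.dimension_is_inj[OF K R.dimension_simple_extension[OF K _ alg']] by simp
  have Span: "R.Span K (R.exp_base \<alpha> n) = adjoin K \<alpha>"
    using R.Span_exp_base[OF K _ alg'] by (simp add: L flip: n)
  have indep: "R.independent K (R.exp_base \<alpha> n)"
    using R.exp_base_independent[OF K _ alg'] by (simp flip: n)
  have combine: "R.combine (map (Polynomial.coeff p) (rev [0..<n])) (R.exp_base \<alpha> n) = poly p \<alpha>"
    if "p = 0 \<or> Polynomial.degree p < n" for p
  proof -
    let ?cs = "map (Polynomial.coeff p) (rev [0..<n])"
    have "R.combine ?cs (R.exp_base \<alpha> n) = R.eval ?cs \<alpha>"
      using R.combine_eq_eval[of ?cs \<alpha>] by simp
    also have "\<dots> = poly (Poly (map (Polynomial.coeff p) [0..<n])) \<alpha>"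
      by (simp add: eval_ring_of_type rev_map)
    also have "Poly (map (Polynomial.coeff p) [0..<n]) = p"
      using that by (intro poly_eqI) (auto simp: nth_default_def Polynomial.coeff_eq_0)
    finally show ?thesis .
  qed
  show "p = 0" if p: "p \<in> polys_over K" "Polynomial.degree p < n" "poly p \<alpha> = 0" for p
  proof (rule poly_eqI)
    fix i
    let ?cs = "map (Polynomial.coeff p) (rev [0..<n])"
    have "set ?cs \<subseteq> K"
      using p S.coeff_mem by auto
    then have *: "set (take (length (R.exp_base \<alpha> n)) ?cs) \<subseteq> {0}"
      using R.independent_imp_trivial_combine[OF K indep, of ?cs] combine[of p] p by simp
    have "length (R.exp_base \<alpha> n) = n"
      by (simp add: R.exp_base_def)
    with * have *: "set ?cs \<subseteq> {0}"
      by simp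
    show "Polynomial.coeff p i = Polynomial.coeff 0 i"
    proof (cases "i < n")
      case True
      then have "Polynomial.coeff p i \<in> set ?cs" by auto
      with * show ?thesis by auto
    qed (use p in \<open>simp add: Polynomial.coeff_eq_0\<close>)
  qed
  have "R.Span K (R.exp_base \<alpha> n) =
      {R.combine Ks (R.exp_base \<alpha> n) | Ks. length Ks = length (R.exp_base \<alpha> n) \<and> set Ks \<subseteq> K}"
    by (rule R.Span_eq_combine_set_length_version[OF K]) simp
  also have "\<dots> = {poly p \<alpha> | p. p \<in> polys_over K \<and> (p = 0 \<or> Polynomial.degree p < n)}"
  proof (intro equalityI subsetI)
    fix y assume "y \<in> {R.combine Ks (R.exp_base \<alpha> n) | Ks. length Ks = length (R.exp_base \<alpha> n) \<and> set Ks \<subseteq> K}"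
    then obtain Ks where Ks: "y = R.combine Ks (R.exp_base \<alpha> n)" "length Ks = n" "set Ks \<subseteq> K"
      by (auto simp: R.exp_base_def)
    define p where "p = Poly (rev Ks)"
    have "y = poly p \<alpha>"
      using R.combine_eq_eval[of Ks \<alpha>] Ks by (simp add: eval_ring_of_type p_def)
    moreover have "p \<in> polys_over K"
      using Ks(3) by (auto simp: polys_over_def p_def nth_default_def S.zero_mem rev_nth)
    moreover have "p = 0 \<or> Polynomial.degree p < n"
    proof -
      have "Polynomial.coeff p i = 0" if "i \<ge> n" for i
        using that Ks(2) by (simp add: p_def nth_default_def)
      then show ?thesis
        using leading_coeff_0_iff[of p] by (cases "Polynomial.degree p < n") auto
    qed
    ultimately show "y \<in> {poly p \<alpha> | p. p \<in> polys_over K \<and> (p = 0 \<or> Polynomial.degree p < n)}"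
      by blast
  next
    fix y assume "y \<in> {poly p \<alpha> | p. p \<in> polys_over K \<and> (p = 0 \<or> Polynomial.degree p < n)}"
    then obtain p where p: "y = poly p \<alpha>" "p \<in> polys_over K" "p = 0 \<or> Polynomial.degree p < n"
      by blast
    then have "y = R.combine (map (Polynomial.coeff p) (rev [0..<n])) (R.exp_base \<alpha> n)"
      by (simp add: combine)
    moreover have "set (map (Polynomial.coeff p) (rev [0..<n])) \<subseteq> K"
      using p S.coeff_mem by auto
    ultimately show "y \<in> {R.combine Ks (R.exp_base \<alpha> n) | Ks. length Ks = length (R.exp_base \<alpha> n) \<and> set Ks \<subseteq> K}"
      by (force simp: R.exp_base_def)
  qed
  finally show "adjoin K \<alpha> = {poly p \<alpha> | p. p \<in> polys_over K \<and> (p = 0 \<or> Polynomial.degree p < n)}"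
    by (simp only: Span)
qed

lemma algebraic_imp_poly_root:
  fixes K :: "'f::field set"
  assumes K: "subfield K (ring_of_type_algebra :: 'f ring)"
    and alg: "ring.algebraic (ring_of_type_algebra :: 'f ring) K x"
  obtains p where "p \<in> polys_over K" "p \<noteq> 0" "poly p x = 0"
proof -
  let ?R = "ring_of_type_algebra :: 'f ring"
  interpret R: field ?R by (rule field_from_type_algebra)
  interpret S: subfield_of_type K by (rule subfield_imp_subfield_of_type[OF K])
  obtain cs where cs: "cs \<in> carrier (K [X]\<^bsub>?R\<^esub>)" "cs \<noteq> []" "R.eval cs x = 0"
    using R.algebraicE[OF subfieldE(1)[OF K], of x] alg by (auto simp: over_def)
  then have cs': "set cs \<subseteq> K" "hd cs \<noteq> 0"
    by (auto simp: univ_poly_def polynomial_def)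
  show thesis
  proof (rule that)
    show "Poly (rev cs) \<in> polys_over K"
      using cs' by (auto simp: polys_over_def nth_default_def S.zero_mem rev_nth)
    have "Polynomial.coeff (Poly (rev cs)) (length cs - 1) = hd cs"
      using cs by (simp add: nth_default_def rev_nth hd_conv_nth)
    with cs' show "Poly (rev cs) \<noteq> 0" by (metis Polynomial.coeff_0)
    show "poly (Poly (rev cs)) x = 0"
      using cs by (simp add: eval_ring_of_type)
  qed
qed

lemma proots_prod_linear: "proots (\<Prod>x\<in>#A. [:- x, 1:]) = (A :: 'a::idom multiset)"
proof (induction A)
  case (add x A)
  have "(\<Prod>x\<in>#A. [:- x, 1:]) \<noteq> 0"
    by (auto simp: prod_mset_zero_iff)
  then show ?case
    using add by (simp add: proots_mult del: mult_pCons_left)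
qed simp

lemma size_proots_alg_closed: "size (proots (p :: 'a::alg_closed_field poly)) = Polynomial.degree p"
proof (cases "p = 0")
  case False
  then obtain A where A: "size A = Polynomial.degree p"
    "p = Polynomial.smult (Polynomial.lead_coeff p) (\<Prod>x\<in>#A. [:- x, 1:])"
    using alg_closed_imp_factorization by blast
  have "proots p = proots (\<Prod>x\<in>#A. [:- x, 1:])"
    by (subst A(2), rule proots_smult) (use False in simp)
  then show ?thesis
    using A(1) by (simp add: proots_prod_linear)
qed simp

locale power_basis = K: subfield_of_type K + L: subfield_of_type L
  for K L :: "'f::{alg_closed_field, field_char_0} set" +
  fixes \<alpha> :: 'f and n :: nat
  assumes alpha_mem: "\<alpha> \<in> L"
    and L_eq: "L = {poly p \<alpha> | p. p \<in> polys_over K \<and> (p = 0 \<or> Polynomial.degree p < n)}"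
    and indep: "p \<in> polys_over K \<Longrightarrow> Polynomial.degree p < n \<Longrightarrow> poly p \<alpha> = 0 \<Longrightarrow> p = 0"
    and algebraic: "\<exists>p\<in>polys_over K. p \<noteq> 0 \<and> poly p x = 0"
begin

lemma n_pos: "n > 0"
proof (rule ccontr)
  assume "\<not> n > 0"
  then have "1 \<in> {0::'f}"
    using L.one_mem unfolding L_eq by auto
  then show False by simp
qed

lemma K_subset: "K \<subseteq> L"
proof
  fix x assume "x \<in> K"
  then have "[:x:] \<in> polys_over K" by (simp add: K.pCons_polys K.zero_polys)
  moreover have "x = poly [:x:] \<alpha>" by simp
  moreover have "Polynomial.degree [:x:] < n" using n_pos by simp
  ultimately show "x \<in> L" unfolding L_eq by blast
qed


lemma ex_poly: "x \<in> L \<Longrightarrow> \<exists>p\<in>polys_over K. x = poly p \<alpha> \<and> (p = 0 \<or> Polynomial.degree p < n)"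
  unfolding L_eq by blast

definition minpoly :: "'f poly" where
  "minpoly = (SOME m. m \<in> polys_over K \<and> m \<noteq> 0 \<and> Polynomial.degree m = n \<and> poly m \<alpha> = 0)"

lemma minpoly: "minpoly \<in> polys_over K" "minpoly \<noteq> 0" "Polynomial.degree minpoly = n" "poly minpoly \<alpha> = 0"
proof -
  obtain p where p: "p \<in> polys_over K" "\<alpha> ^ n = poly p \<alpha>" "p = 0 \<or> Polynomial.degree p < n"
    using ex_poly[OF L.power_mem[OF alpha_mem]] by blast
  have deg: "Polynomial.degree (Polynomial.monom 1 n - p) = n"
    using p(3) n_pos Polynomial.degree_add_eq_left[of "- p" "Polynomial.monom 1 n"]
    by (auto simp: Polynomial.degree_monom_eq)
  have "Polynomial.monom 1 n - p \<in> polys_over K \<and> Polynomial.monom 1 n - p \<noteq> 0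
      \<and> Polynomial.degree (Polynomial.monom 1 n - p) = n \<and> poly (Polynomial.monom 1 n - p) \<alpha> = 0"
    using deg p n_pos by (auto intro: K.polys K.one_mem simp: poly_monom)
  then have "minpoly \<in> polys_over K \<and> minpoly \<noteq> 0 \<and> Polynomial.degree minpoly = n \<and> poly minpoly \<alpha> = 0"
    unfolding minpoly_def by (rule someI)
  then show "minpoly \<in> polys_over K" "minpoly \<noteq> 0" "Polynomial.degree minpoly = n" "poly minpoly \<alpha> = 0"
    by blast+
qed

lemma root_transfer:
  assumes "p \<in> polys_over K" "poly p \<alpha> = 0" "poly minpoly \<beta> = 0"
  shows "poly p \<beta> = 0"
proof -
  obtain k r where kr: "k \<in> polys_over K" "r \<in> polys_over K" "p = minpoly * k + r"
    "r = 0 \<or> Polynomial.degree r < n"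
    using K.polys_division[OF assms(1) minpoly(1,2)] unfolding minpoly(3) by blast
  have "poly r \<alpha> = 0"
    using kr(3) assms(2) minpoly(4) by simp
  then have "r = 0"
    using kr indep by blast
  then show ?thesis
    using kr(3) assms(3) by simp
qed

lemma root_transfer_back:
  assumes p: "p \<in> polys_over K" "poly p \<beta> = 0" and \<beta>: "poly minpoly \<beta> = 0"
  shows "poly p \<alpha> = 0"
proof -
  define P where "P = (\<lambda>g. g \<in> polys_over K \<and> g \<noteq> 0 \<and> poly g \<beta> = 0)"
  define g where "g = arg_min Polynomial.degree P"
  have "P minpoly"
    using minpoly \<beta> by (simp add: P_def)
  then have g: "P g" and least: "\<And>h. P h \<Longrightarrow> Polynomial.degree g \<le> Polynomial.degree h"
    using arg_min_nat_lemma[of P minpoly Polynomial.degree] by (simp_all add: g_def)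
  have dvd: "\<exists>k\<in>polys_over K. h = g * k" if h: "h \<in> polys_over K" "poly h \<beta> = 0" for h
  proof -
    obtain k r where kr: "k \<in> polys_over K" "r \<in> polys_over K" "h = g * k + r"
      "r = 0 \<or> Polynomial.degree r < Polynomial.degree g"
      using K.polys_division[OF h(1), of g] g unfolding P_def by blast
    have "poly r \<beta> = 0"
      using kr(3) h(2) g by (simp add: P_def)
    then have "r = 0"
      using least[of r] kr unfolding P_def by fastforce
    with kr show ?thesis by auto
  qed
  obtain k where k: "k \<in> polys_over K" "minpoly = g * k"
    using dvd[OF minpoly(1) \<beta>] by blast
  have nz: "g \<noteq> 0" "k \<noteq> 0"
    using k(2) minpoly(2) by auto
  have deg: "n = Polynomial.degree g + Polynomial.degree k"
    using Polynomial.degree_mult_eq[OF nz] k(2) minpoly(3) by simp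
  have "Polynomial.degree g > 0"
  proof (rule ccontr)
    assume "\<not> Polynomial.degree g > 0"
    then obtain c where "g = [:c:]"
      using degree_eq_zeroE[of g] by blast
    with g show False
      by (auto simp: P_def)
  qed
  then have "poly k \<alpha> \<noteq> 0"
    using indep[OF k(1)] deg nz by auto
  then have "poly g \<alpha> = 0"
    using minpoly(4) k(2) by simp
  then show ?thesis
    using dvd[OF p] by auto
qed

lemma minpoly_separable:
  assumes "poly minpoly \<beta> = 0"
  shows "poly (pderiv minpoly) \<beta> \<noteq> 0"
proof
  assume "poly (pderiv minpoly) \<beta> = 0"
  then have "poly (pderiv minpoly) \<alpha> = 0"
    by (rule root_transfer_back[OF K.pderiv_polys[OF minpoly(1)] _ assms])
  moreover have "Polynomial.degree (pderiv minpoly) < n"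
    using n_pos minpoly(3) by (simp add: degree_pderiv)
  ultimately have "pderiv minpoly = 0"
    using indep K.pderiv_polys[OF minpoly(1)] by blast
  then show False
    using n_pos minpoly(3) by (simp add: pderiv_eq_0_iff)
qed

lemma card_roots_minpoly: "card {\<beta>. poly minpoly \<beta> = 0} = n"
proof -
  have "order \<beta> minpoly = 1" if "poly minpoly \<beta> = 0" for \<beta>
  proof -
    have "pderiv minpoly \<noteq> 0"
      using minpoly_separable[OF that] by auto
    moreover have "order \<beta> minpoly \<noteq> 0"
      using that minpoly(2) by (simp add: order_root)
    ultimately show ?thesis
      using order_pderiv[of minpoly \<beta>] order_0I[OF minpoly_separable[OF that]] that minpoly(2) by simp
  qed
  then have count: "count (proots minpoly) \<beta> = (if \<beta> \<in># proots minpoly then 1 else 0)" for \<beta>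
    using minpoly(2) by (auto simp: order_root)
  have "proots minpoly = mset_set (set_mset (proots minpoly))"
  proof (rule multiset_eqI)
    show "count (proots minpoly) \<beta> = count (mset_set (set_mset (proots minpoly))) \<beta>" for \<beta>
      unfolding count by (simp only: count_mset_set' finite_set_mset simp_thms)
  qed
  then have "size (proots minpoly) = card (set_mset (proots minpoly))"
    using size_mset_set[of "set_mset (proots minpoly)"] by argo
  then show ?thesis
    using minpoly(2,3) size_proots_alg_closed[of minpoly] by (simp add: set_count_proots)
qed

definition conjugate_map :: "'f \<Rightarrow> 'f \<Rightarrow> 'f" where
  "conjugate_map \<beta> x = poly (SOME p. p \<in> polys_over K \<and> poly p \<alpha> = x) \<beta>"

lemma conjugate_map_poly:
  assumes "poly minpoly \<beta> = 0" "p \<in> polys_over K"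
  shows "conjugate_map \<beta> (poly p \<alpha>) = poly p \<beta>"
proof -
  define q where "q = (SOME q. q \<in> polys_over K \<and> poly q \<alpha> = poly p \<alpha>)"
  have q: "q \<in> polys_over K \<and> poly q \<alpha> = poly p \<alpha>"
    unfolding q_def by (rule someI[of _ p]) (use assms in simp)
  have "q - p \<in> polys_over K" "poly (q - p) \<alpha> = 0"
    using q assms by (simp_all add: K.diff_polys)
  then have "poly (q - p) \<beta> = 0"
    using root_transfer assms by blast
  then show ?thesis
    by (simp add: conjugate_map_def q_def)
qed

lemma conjugate_exists:
  assumes e: "e \<in> L" "e \<notin> K"
  obtains \<beta> where "poly minpoly \<beta> = 0" "conjugate_map \<beta> e \<noteq> e"
proof -
  obtain E where E: "E \<in> polys_over K" "e = poly E \<alpha>" "E = 0 \<or> Polynomial.degree E < n"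
    using ex_poly[OF e(1)] by blast
  have "\<exists>\<beta>. poly minpoly \<beta> = 0 \<and> poly E \<beta> \<noteq> e"
  proof (rule ccontr)
    assume "\<nexists>\<beta>. poly minpoly \<beta> = 0 \<and> poly E \<beta> \<noteq> e"
    then have sub: "{\<beta>. poly minpoly \<beta> = 0} \<subseteq> {\<beta>. poly (E - [:e:]) \<beta> = 0}"
      by auto
    have deg: "Polynomial.degree (E - [:e:]) < n"
      using E(3) n_pos by (auto simp: Polynomial.degree_diff_less)
    show False
    proof (cases "E - [:e:] = 0")
      case True
      then have "Polynomial.coeff E 0 = e" by simp
      then show False using K.coeff_mem[OF E(1), of 0] e by simp
    next
      case False
      then have "n \<le> card {\<beta>. poly (E - [:e:]) \<beta> = 0}"
        using card_mono[OF poly_roots_finite[OF False] sub] card_roots_minpoly by simp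
      also have "\<dots> \<le> Polynomial.degree (E - [:e:])"
        by (rule card_poly_roots_bound) fact
      finally show False using deg by simp
    qed
  qed
  then show thesis
    using that conjugate_map_poly[OF _ E(1)] E(2) by auto
qed

context
  fixes \<beta> assumes \<beta>: "poly minpoly \<beta> = 0"
begin

lemma conjugate_map_base: "k \<in> K \<Longrightarrow> conjugate_map \<beta> k = k"
  using conjugate_map_poly[OF \<beta>, of "[:k:]"] by (simp add: K.pCons_polys K.zero_polys)

lemma conjugate_map_add:
  assumes "x \<in> L" "y \<in> L"
  shows "conjugate_map \<beta> (x + y) = conjugate_map \<beta> x + conjugate_map \<beta> y"
proof -
  obtain p q where "p \<in> polys_over K" "x = poly p \<alpha>" "q \<in> polys_over K" "y = poly q \<alpha>"
    using ex_poly assms by blast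
  then show ?thesis
    using conjugate_map_poly[OF \<beta> K.add_polys, of p q] by (simp add: conjugate_map_poly[OF \<beta>])
qed

lemma conjugate_map_mult:
  assumes "x \<in> L" "y \<in> L"
  shows "conjugate_map \<beta> (x * y) = conjugate_map \<beta> x * conjugate_map \<beta> y"
proof -
  obtain p q where "p \<in> polys_over K" "x = poly p \<alpha>" "q \<in> polys_over K" "y = poly q \<alpha>"
    using ex_poly assms by blast
  then show ?thesis
    using conjugate_map_poly[OF \<beta> K.mult_polys, of p q] by (simp add: conjugate_map_poly[OF \<beta>])
qed

lemma conjugate_map_eq_0: "x \<in> L \<Longrightarrow> conjugate_map \<beta> x = 0 \<Longrightarrow> x = 0"
  using ex_poly[of x] by (auto simp: conjugate_map_poly[OF \<beta>] intro: root_transfer_back[OF _ _ \<beta>])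

end

end

section \<open>Evaluation of multivariate polynomials\<close>

lemma mpoly_induct [case_names zero single add]:
  assumes "P 0" "\<And>m c. P (Poly_Mapping.single m c)" "\<And>p q. P p \<Longrightarrow> P q \<Longrightarrow> P (p + q)"
  shows "P (p :: 'a::comm_monoid_add mpoly)"
proof (induction p rule: update_induct)
  case const
  show ?case by (rule assms(1))
next
  case (update f a b)
  have "Poly_Mapping.update a b f = Poly_Mapping.single a b + f"
    using update by (intro poly_mapping_eqI)
      (auto simp: lookup_update lookup_add lookup_single when_def in_keys_iff)
  then show ?case
    using assms(2,3) update.IH by simp
qed

definition total_degree :: "(nat \<Rightarrow>\<^sub>0 nat) \<Rightarrow> nat" where
  "total_degree m = (\<Sum>i\<in>Poly_Mapping.keys m. Poly_Mapping.lookup m i)"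

definition monomial_eval :: "'b::comm_semiring_1 vec \<Rightarrow> (nat \<Rightarrow>\<^sub>0 nat) \<Rightarrow> 'b" where
  "monomial_eval x m = (\<Prod>i\<in>Poly_Mapping.keys m. (x $ i) ^ Poly_Mapping.lookup m i)"

lemma total_degree_0 [simp]: "total_degree 0 = 0"
  by (simp add: total_degree_def)

lemma total_degree_single [simp]: "total_degree (Poly_Mapping.single i k) = k"
  by (cases "k = 0") (simp_all add: total_degree_def)

lemma total_degree_add: "total_degree (l + m) = total_degree l + total_degree m"
  unfolding total_degree_def by (rule setsum_keys_plus_distrib) auto

lemma monomial_eval_0 [simp]: "monomial_eval x 0 = 1"
  by (simp add: monomial_eval_def)

lemma monomial_eval_single [simp]: "monomial_eval x (Poly_Mapping.single i k) = (x $ i) ^ k"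
  by (cases "k = 0") (simp_all add: monomial_eval_def)

lemma monomial_eval_superset:
  assumes "finite A" "Poly_Mapping.keys m \<subseteq> A"
  shows "monomial_eval x m = (\<Prod>i\<in>A. (x $ i) ^ Poly_Mapping.lookup m i)"
  unfolding monomial_eval_def using assms
  by (intro prod.mono_neutral_left) (auto simp: in_keys_iff)

lemma monomial_eval_add: "monomial_eval x (l + m) = monomial_eval x l * monomial_eval x m"
proof -
  let ?A = "Poly_Mapping.keys l \<union> Poly_Mapping.keys m"
  have "monomial_eval x (l + m) = (\<Prod>i\<in>?A. (x $ i) ^ Poly_Mapping.lookup (l + m) i)"
    by (rule monomial_eval_superset) (auto dest: subsetD[OF keys_add])
  also have "\<dots> = (\<Prod>i\<in>?A. (x $ i) ^ Poly_Mapping.lookup l i) * (\<Prod>i\<in>?A. (x $ i) ^ Poly_Mapping.lookup m i)"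
    by (simp add: lookup_add power_add prod.distrib)
  also have "\<dots> = monomial_eval x l * monomial_eval x m"
    by (simp flip: monomial_eval_superset)
  finally show ?thesis .
qed

lemma monomial_eval_smult:
  assumes "x \<in> carrier_vec N" "Poly_Mapping.keys m \<subseteq> {..<N}"
  shows "monomial_eval (c \<cdot>\<^sub>v x) m = c ^ total_degree m * monomial_eval x m"
proof -
  have "monomial_eval (c \<cdot>\<^sub>v x) m
      = (\<Prod>i\<in>Poly_Mapping.keys m. c ^ Poly_Mapping.lookup m i * (x $ i) ^ Poly_Mapping.lookup m i)"
    unfolding monomial_eval_def using assms
    by (intro prod.cong) (auto simp: power_mult_distrib)
  then show ?thesis
    by (simp add: prod.distrib monomial_eval_def total_degree_def power_sum)
qed

lemma mpoly_eval_altdef: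
  "mpoly_eval h x P = (\<Sum>m\<in>Poly_Mapping.keys P. h (Poly_Mapping.lookup P m) * monomial_eval x m)"
  by (simp add: mpoly_eval_def monomial_eval_def)

lemma mpoly_eval_0 [simp]: "mpoly_eval h x 0 = 0"
  by (simp add: mpoly_eval_def)

context comm_ring_hom
begin

lemma mpoly_eval_single [simp]: "mpoly_eval hom x (Poly_Mapping.single m c) = hom c * monomial_eval x m"
  by (cases "c = 0") (simp_all add: mpoly_eval_altdef)

lemma mpoly_eval_add [simp]: "mpoly_eval hom x (P + Q) = mpoly_eval hom x P + mpoly_eval hom x Q"
  unfolding mpoly_eval_altdef
  by (rule setsum_keys_plus_distrib) (auto simp: hom_distribs algebra_simps)

lemma mpoly_eval_uminus [simp]: "mpoly_eval hom x (- P) = - mpoly_eval hom x P"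
  using mpoly_eval_add[of x P "- P"] by (simp add: eq_neg_iff_add_eq_0 add.commute)

lemma mpoly_eval_diff [simp]: "mpoly_eval hom x (P - Q) = mpoly_eval hom x P - mpoly_eval hom x Q"
  using mpoly_eval_add[of x P "- Q"] by simp

lemma mpoly_eval_sum [simp]: "mpoly_eval hom x (sum P I) = (\<Sum>i\<in>I. mpoly_eval hom x (P i))"
  by (induction I rule: infinite_finite_induct) simp_all

lemma mpoly_eval_mult [simp]: "mpoly_eval hom x (P * Q) = mpoly_eval hom x P * mpoly_eval hom x Q"
proof (induction P rule: mpoly_induct)
  case (single m c)
  show ?case
    by (induction Q rule: mpoly_induct)
      (simp_all add: mult_single monomial_eval_add hom_distribs algebra_simps)
qed (simp_all add: algebra_simps)

end

lemma mpoly_eval_hom: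
  assumes f: "comm_ring_hom f" and x: "x \<in> carrier_vec N" and P: "P \<in> mpolys N"
  shows "f (mpoly_eval h x P) = mpoly_eval (f \<circ> h) (map_vec f x) P"
proof -
  interpret f: comm_ring_hom f by fact
  have "f (monomial_eval x m) = monomial_eval (map_vec f x) m" if "m \<in> Poly_Mapping.keys P" for m
  proof -
    have "Poly_Mapping.keys m \<subseteq> {..<N}"
      using P that by (auto simp: mpolys_def)
    then show ?thesis
      using x unfolding monomial_eval_def
      by (auto simp: f.hom_prod f.hom_power intro!: prod.cong)
  qed
  then show ?thesis
    by (simp add: mpoly_eval_altdef f.hom_sum f.hom_mult)
qed

lemma mpoly_eval_smult:
  assumes "x \<in> carrier_vec N" "P \<in> mpolys N" "\<And>m. m \<in> Poly_Mapping.keys P \<Longrightarrow> total_degree m = d"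
  shows "mpoly_eval h (c \<cdot>\<^sub>v x) P = c ^ d * mpoly_eval h x P"
  using assms monomial_eval_smult[OF assms(1), of _ c]
  by (auto simp: mpoly_eval_altdef sum_distrib_left mpolys_def ac_simps intro!: sum.cong)

lemma homogeneousE:
  assumes "homogeneous P"
  obtains d where "\<And>m. m \<in> Poly_Mapping.keys P \<Longrightarrow> total_degree m = d"
  using assms by (auto simp: homogeneous_def total_degree_def)

definition forms :: "nat \<Rightarrow> nat \<Rightarrow> 'a::zero mpoly set" where
  "forms N d = {P \<in> mpolys N. \<forall>m\<in>Poly_Mapping.keys P. total_degree m = d}"

lemma forms_mpolys: "P \<in> forms N d \<Longrightarrow> P \<in> mpolys N"
  and forms_homogeneous: "P \<in> forms N d \<Longrightarrow> homogeneous P"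
  by (auto simp: forms_def homogeneous_def total_degree_def)

lemma keys_uminus_mpoly: "Poly_Mapping.keys (- P) = Poly_Mapping.keys (P :: 'a::ab_group_add mpoly)"
  by (auto simp: in_keys_iff)

lemma mpolys_zero: "0 \<in> mpolys N"
  by (simp add: mpolys_def)

lemma mpolys_const: "Poly_Mapping.single 0 c \<in> mpolys N"
  by (cases "c = 0") (simp_all add: mpolys_def)

lemma mpolys_var: "i < N \<Longrightarrow> Poly_Mapping.single (Poly_Mapping.single i 1) c \<in> mpolys N"
  by (cases "c = 0") (simp_all add: mpolys_def)

lemma mpolys_add: "P \<in> mpolys N \<Longrightarrow> Q \<in> mpolys N \<Longrightarrow> P + Q \<in> mpolys N"
  using keys_add[of P Q] by (auto simp: mpolys_def)

lemma mpolys_uminus: "P \<in> mpolys N \<Longrightarrow> - P \<in> mpolys N" for P :: "'a::ab_group_add mpoly"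
  by (simp add: mpolys_def keys_uminus_mpoly)

lemma mpolys_diff: "P \<in> mpolys N \<Longrightarrow> Q \<in> mpolys N \<Longrightarrow> P - Q \<in> mpolys N" for P :: "'a::ab_group_add mpoly"
  using mpolys_add[OF _ mpolys_uminus, of P N Q] by simp

lemma mpolys_mult:
  assumes "P \<in> mpolys N" "Q \<in> mpolys N"
  shows "P * Q \<in> mpolys N"
  unfolding mpolys_def mem_Collect_eq
proof
  fix m assume "m \<in> Poly_Mapping.keys (P * Q)"
  then obtain a b where "m = a + b" "a \<in> Poly_Mapping.keys P" "b \<in> Poly_Mapping.keys Q"
    using keys_mult[of P Q] by blast
  then show "Poly_Mapping.keys m \<subseteq> {..<N}"
    using assms keys_add[of a b] unfolding mpolys_def by blast
qed

lemma mpolys_sum: "(\<And>i. i \<in> I \<Longrightarrow> P i \<in> mpolys N) \<Longrightarrow> sum P I \<in> mpolys N"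
  by (induction I rule: infinite_finite_induct) (auto intro: mpolys_zero mpolys_add)

lemma forms_zero: "0 \<in> forms N d"
  by (simp add: forms_def mpolys_zero)

lemma forms_const: "Poly_Mapping.single 0 c \<in> forms N 0"
  using mpolys_const[of c N] by (cases "c = 0") (simp_all add: forms_def)

lemma forms_var: "i < N \<Longrightarrow> Poly_Mapping.single (Poly_Mapping.single i 1) c \<in> forms N 1"
  using mpolys_var[of i N c] by (cases "c = 0") (simp_all add: forms_def)

lemma forms_add: "P \<in> forms N d \<Longrightarrow> Q \<in> forms N d \<Longrightarrow> P + Q \<in> forms N d"
  using keys_add[of P Q] by (auto simp: forms_def mpolys_add)

lemma forms_diff: "P \<in> forms N d \<Longrightarrow> Q \<in> forms N d \<Longrightarrow> P - Q \<in> forms N d" for P :: "'a::ab_group_add mpoly"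
  using forms_add[of P N d "- Q"] by (simp add: forms_def mpolys_uminus keys_uminus_mpoly)

lemma forms_mult:
  assumes "P \<in> forms N d" "Q \<in> forms N e"
  shows "P * Q \<in> forms N (d + e)"
  unfolding forms_def mem_Collect_eq
proof (intro conjI ballI)
  show "P * Q \<in> mpolys N"
    using assms by (intro mpolys_mult forms_mpolys)
  fix m assume "m \<in> Poly_Mapping.keys (P * Q)"
  then obtain a b where "m = a + b" "a \<in> Poly_Mapping.keys P" "b \<in> Poly_Mapping.keys Q"
    using keys_mult[of P Q] by blast
  then show "total_degree m = d + e"
    using assms by (simp add: forms_def total_degree_add)
qed

lemma forms_sum: "(\<And>i. i \<in> I \<Longrightarrow> P i \<in> forms N d) \<Longrightarrow> sum P I \<in> forms N d"
  by (induction I rule: infinite_finite_induct) (auto intro: forms_zero forms_add)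

lemma forms_scale: "P \<in> forms N d \<Longrightarrow> Poly_Mapping.single 0 c * P \<in> forms N d"
  using forms_mult[OF forms_const] by fastforce

section \<open>Power series over a subfield\<close>

context subfield_of_type
begin

lemma fps_nth_mem: "f \<in> fps_over S \<Longrightarrow> fps_nth f k \<in> S"
  by (simp add: fps_over_def)

lemma fps_overI: "(\<And>k. fps_nth f k \<in> S) \<Longrightarrow> f \<in> fps_over S"
  by (simp add: fps_over_def)

lemma fps_over_const: "c \<in> S \<Longrightarrow> fps_const c \<in> fps_over S"
  by (simp add: fps_over_def zero_mem)

lemma fps_over_X: "fps_X \<in> fps_over S"
  by (simp add: fps_over_def fps_X_def mem)

lemma fps_over_1: "1 \<in> fps_over S"
  by (simp add: fps_over_def mem)

lemma fps_over_add: "f \<in> fps_over S \<Longrightarrow> g \<in> fps_over S \<Longrightarrow> f + g \<in> fps_over S"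
  by (simp add: fps_over_def mem)

lemma fps_over_diff: "f \<in> fps_over S \<Longrightarrow> g \<in> fps_over S \<Longrightarrow> f - g \<in> fps_over S"
  by (simp add: fps_over_def mem)

lemma fps_over_mult: "f \<in> fps_over S \<Longrightarrow> g \<in> fps_over S \<Longrightarrow> f * g \<in> fps_over S"
  by (auto simp: fps_over_def fps_mult_nth intro!: mem)

lemma fps_over_power: "f \<in> fps_over S \<Longrightarrow> f ^ k \<in> fps_over S"
  by (induction k) (auto intro: fps_over_1 fps_over_mult)

lemma fps_over_compose: "f \<in> fps_over S \<Longrightarrow> g \<in> fps_over S \<Longrightarrow> fps_compose f g \<in> fps_over S"
  by (rule fps_overI) (simp add: fps_compose_nth sum_mem mult_mem fps_nth_mem fps_over_power)

lemma fps_over_inverse: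
  assumes f: "f \<in> fps_over S" "fps_nth f 0 \<noteq> 0"
  shows "inverse f \<in> fps_over S"
proof (rule fps_overI)
  fix k
  let ?g = "inverse f"
  show "fps_nth ?g k \<in> S"
  proof (induction k rule: less_induct)
    case (less k)
    show ?case
    proof (cases "k = 0")
      case True
      then show ?thesis
        using f by (simp add: fps_nth_mem mem)
    next
      case False
      have "f * ?g = 1"
        using f by (simp add: inverse_mult_eq_1')
      then have "0 = fps_nth (f * ?g) k"
        using False by simp
      also have "\<dots> = fps_nth f 0 * fps_nth ?g k + (\<Sum>i=1..k. fps_nth f i * fps_nth ?g (k - i))"
        by (simp add: fps_mult_nth sum.atLeast_Suc_atMost)
      finally have "fps_nth ?g k = - (\<Sum>i=1..k. fps_nth f i * fps_nth ?g (k - i)) / fps_nth f 0"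
        using f(2) by (simp add: field_simps eq_neg_iff_add_eq_0)
      also have "\<dots> \<in> S"
        using f less by (auto intro!: divide_mem uminus_mem sum_mem mult_mem intro: fps_nth_mem[OF f(1)])
      finally show ?thesis .
    qed
  qed
qed

lemma fps_over_fps_inv:
  assumes f: "f \<in> fps_over S"
  shows "fps_inv f \<in> fps_over S"
proof (rule fps_overI)
  fix k
  show "fps_nth (fps_inv f) k \<in> S"
  proof (induction k rule: less_induct)
    case (less k)
    show ?case
    proof (cases k)
      case 0
      then show ?thesis by (simp add: fps_inv_def zero_mem)
    next
      case (Suc l)
      have "compinv f i \<in> S" if "i \<le> l" for i
        using less[of i] that Suc by (simp add: fps_inv_def)
      then show ?thesis
        unfolding fps_inv_def Suc fps_nth_Abs_fps compinv.simps using f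
        by (intro divide_mem diff_mem sum_mem mult_mem power_mem fps_nth_mem fps_over_power fps_over_X) auto
    qed
  qed
qed

lemma param_equiv_refl: "param_equiv S a a"
  unfolding param_equiv_def
  by (rule bexI[of _ fps_X], rule bexI[of _ 1]) (auto simp: fps_over_X fps_over_1 intro!: eq_vecI)

lemma param_equiv_trans:
  assumes "param_equiv S a b" "param_equiv S b c"
  shows "param_equiv S a c"
proof -
  obtain T \<rho> where 1: "T \<in> fps_over S" "\<rho> \<in> fps_over S" "fps_nth T 0 = 0" "fps_nth T 1 \<noteq> 0"
    "fps_nth \<rho> 0 \<noteq> 0" "b = \<rho> \<cdot>\<^sub>v map_vec (\<lambda>f. fps_compose f T) a"
    using assms(1) unfolding param_equiv_def by blast
  obtain T' \<rho>' where 2: "T' \<in> fps_over S" "\<rho>' \<in> fps_over S" "fps_nth T' 0 = 0" "fps_nth T' 1 \<noteq> 0"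
    "fps_nth \<rho>' 0 \<noteq> 0" "c = \<rho>' \<cdot>\<^sub>v map_vec (\<lambda>f. fps_compose f T') b"
    using assms(2) unfolding param_equiv_def by blast
  show ?thesis
    unfolding param_equiv_def
  proof (rule bexI[of _ "fps_compose T T'"], rule bexI[of _ "\<rho>' * fps_compose \<rho> T'"], intro conjI)
    show "fps_compose T T' \<in> fps_over S" "\<rho>' * fps_compose \<rho> T' \<in> fps_over S"
      using 1 2 by (auto intro: fps_over_compose fps_over_mult)
    show "fps_nth (fps_compose T T') 0 = 0" "fps_nth (fps_compose T T') 1 \<noteq> 0"
      using 1 2 by (simp_all add: fps_compose_nth sum.atLeast_Suc_atMost)
    show "fps_nth (\<rho>' * fps_compose \<rho> T') 0 \<noteq> 0"
      using 1 2 by simp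
    show "c = (\<rho>' * fps_compose \<rho> T') \<cdot>\<^sub>v map_vec (\<lambda>f. fps_compose f (fps_compose T T')) a"
      using 1 2 by (intro eq_vecI) (simp_all add: fps_compose_mult_distrib fps_compose_assoc mult.assoc)
  qed
qed

lemma param_equiv_sym:
  assumes "param_equiv S a b"
  shows "param_equiv S b a"
proof -
  obtain T \<rho> where 1: "T \<in> fps_over S" "\<rho> \<in> fps_over S" "fps_nth T 0 = 0" "fps_nth T 1 \<noteq> 0"
    "fps_nth \<rho> 0 \<noteq> 0" "b = \<rho> \<cdot>\<^sub>v map_vec (\<lambda>f. fps_compose f T) a"
    using assms(1) unfolding param_equiv_def by blast
  define R where "R = fps_inv T"
  have R: "R \<in> fps_over S" "fps_nth R 0 = 0" "fps_nth R 1 \<noteq> 0" "fps_compose T R = fps_X"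
    using 1 fps_inv_right[OF 1(3,4)] fps_over_fps_inv[OF 1(1)] by (simp_all add: R_def) (simp_all add: fps_inv_def)
  define \<rho>' where "\<rho>' = fps_compose \<rho> R"
  have \<rho>': "\<rho>' \<in> fps_over S" "fps_nth \<rho>' 0 \<noteq> 0"
    using 1 R by (simp_all add: \<rho>'_def fps_over_compose)
  show ?thesis
    unfolding param_equiv_def
  proof (rule bexI[of _ R], rule bexI[of _ "inverse \<rho>'"], intro conjI)
    show "a = inverse \<rho>' \<cdot>\<^sub>v map_vec (\<lambda>f. fps_compose f R) b"
    proof (rule eq_vecI)
      fix i assume "i < dim_vec (inverse \<rho>' \<cdot>\<^sub>v map_vec (\<lambda>f. fps_compose f R) b)"
      then have "i < dim_vec a" using 1 by simp
      then have "(inverse \<rho>' \<cdot>\<^sub>v map_vec (\<lambda>f. fps_compose f R) b) $ i = (inverse \<rho>' * \<rho>') * a $ i"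
        using 1 R by (simp add: fps_compose_mult_distrib \<rho>'_def mult.assoc flip: fps_compose_assoc)
      then show "a $ i = (inverse \<rho>' \<cdot>\<^sub>v map_vec (\<lambda>f. fps_compose f R) b) $ i"
        using \<rho>' by (simp add: inverse_mult_eq_1)
    qed (use 1 in simp)
  qed (use R \<rho>' in \<open>auto intro: fps_over_inverse\<close>)
qed

lemma ex1_branch_iff:
  "(\<exists>!B. B \<in> branches_at_infinity S n U) \<longleftrightarrow>
    (\<exists>a. local_param S n (projective_closure n U) a \<and>
        \<not> reducible_param S n (projective_closure n U) a \<and> fps_nth (a $ 0) 0 = 0) \<and>
    (\<forall>a b. local_param S n (projective_closure n U) a \<and>
        \<not> reducible_param S n (projective_closure n U) a \<and> fps_nth (a $ 0) 0 = 0 \<longrightarrow>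
      local_param S n (projective_closure n U) b \<and>
        \<not> reducible_param S n (projective_closure n U) b \<and> fps_nth (b $ 0) 0 = 0 \<longrightarrow>
      param_equiv S a b)"
proof -
  define A where "A = {a. local_param S n (projective_closure n U) a \<and>
    \<not> reducible_param S n (projective_closure n U) a \<and> fps_nth (a $ 0) 0 = 0}"
  define R where "R = {(a, b). param_equiv S a b}"
  have R: "R `` {a} = {c. param_equiv S a c}" for a
    by (auto simp: R_def)
  have eq: "R `` {a} = R `` {b} \<longleftrightarrow> param_equiv S a b" for a b
  proof
    assume "R `` {a} = R `` {b}"
    then show "param_equiv S a b"
      using param_equiv_refl[of b] unfolding R by blast
  next
    assume ab: "param_equiv S a b"
    show "R `` {a} = R `` {b}"
      unfolding R
      using param_equiv_trans[OF ab] param_equiv_trans[OF param_equiv_sym[OF ab]] by blast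
  qed
  have "(\<exists>!B. B \<in> A // R) \<longleftrightarrow> (\<exists>a. a \<in> A) \<and> (\<forall>a b. a \<in> A \<longrightarrow> b \<in> A \<longrightarrow> R `` {a} = R `` {b})"
    unfolding quotient_def by blast
  also have "\<dots> \<longleftrightarrow> (\<exists>a. a \<in> A) \<and> (\<forall>a b. a \<in> A \<longrightarrow> b \<in> A \<longrightarrow> param_equiv S a b)"
    by (simp only: eq)
  also have "A // R = branches_at_infinity S n U"
    by (simp only: A_def R_def branches_at_infinity_def)
  finally show ?thesis
    by (simp only: A_def mem_Collect_eq)
qed

end


locale subfield_char_0 = subfield_of_type S for S :: "'a::field_char_0 set"
begin

lemma gbinomial_mem: "c \<in> S \<Longrightarrow> c gchoose k \<in> S"
  unfolding gbinomial_prod_rev fact_prod by (intro mem) auto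

lemma fps_over_root:
  assumes v: "v \<in> fps_over S" "fps_nth v 0 = 1" and m: "m > 0"
  obtains w where "w \<in> fps_over S" "fps_nth w 0 = 1" "w ^ m = v"
proof -
  let ?b = "fps_binomial (1 / of_nat m :: 'a)"
  define w where "w = fps_compose ?b (v - 1)"
  have "?b \<in> fps_over S"
    by (intro fps_overI) (auto intro!: gbinomial_mem mem)
  then have "w \<in> fps_over S"
    unfolding w_def using v by (intro fps_over_compose fps_over_diff fps_over_1)
  moreover have "fps_nth w 0 = 1"
    by (simp add: w_def)
  moreover have "w ^ m = fps_compose (?b ^ m) (v - 1)"
    using v by (simp add: w_def fps_compose_power)
  then have "w ^ m = v"
    using m v by (simp add: fps_binomial_power fps_binomial_1 fps_compose_add_distrib)
  ultimately show thesis
    using that by blast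
qed

end

section \<open>Values and components of rational functions\<close>

lemma ratfun_value_intro: "poly q t \<noteq> 0 \<Longrightarrow> ratfun_value (Fract p q) t (poly p t / poly q t)"
  unfolding ratfun_value_def by blast

lemma ratfun_value_Fract:
  assumes "ratfun_value (Fract p q) t v" "q \<noteq> 0"
  shows "v * poly q t = poly p t"
proof -
  obtain p' q' where *: "Fract p q = Fract p' q'" "poly q' t \<noteq> 0" "v = poly p' t / poly q' t"
    using assms(1) unfolding ratfun_value_def by blast
  then have "q' \<noteq> 0" by auto
  with * assms(2) have "p * q' = p' * q"
    by (simp add: eq_fract)
  then have eq: "poly p t * poly q' t = poly p' t * poly q t"
    by (metis poly_mult)
  have "v * poly q t = poly p' t * poly q t / poly q' t"
    using *(3) by simp
  then show ?thesis
    using *(2) by (simp flip: eq)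
qed

lemma ratfun_value_add:
  assumes "ratfun_value f t v" "ratfun_value g t w"
  shows "ratfun_value (f + g) t (v + w)"
proof -
  obtain p q p' q' where *: "f = Fract p q" "poly q t \<noteq> 0" "v = poly p t / poly q t"
    "g = Fract p' q'" "poly q' t \<noteq> 0" "w = poly p' t / poly q' t"
    using assms unfolding ratfun_value_def by blast
  then have "q \<noteq> 0" "q' \<noteq> 0" by auto
  with * show ?thesis
    unfolding ratfun_value_def
    by (intro exI[of _ "p * q' + p' * q"] exI[of _ "q * q'"]) (simp add: add_frac_eq)
qed

lemma ratfun_value_mult:
  assumes "ratfun_value f t v" "ratfun_value g t w"
  shows "ratfun_value (f * g) t (v * w)"
proof -
  obtain p q p' q' where *: "f = Fract p q" "poly q t \<noteq> 0" "v = poly p t / poly q t"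
    "g = Fract p' q'" "poly q' t \<noteq> 0" "w = poly p' t / poly q' t"
    using assms unfolding ratfun_value_def by blast
  then show ?thesis
    unfolding ratfun_value_def
    by (intro exI[of _ "p * p'"] exI[of _ "q * q'"]) simp
qed

lemma ratfun_value_const: "ratfun_value (Fract [:c:] 1) t c"
  using ratfun_value_intro[of 1 t "[:c:]"] by simp

lemma ratfun_value_sum:
  assumes "\<And>i. i \<in> I \<Longrightarrow> ratfun_value (f i) t (v i)"
  shows "ratfun_value (sum f I) t (sum v I)"
  using assms
proof (induction I rule: infinite_finite_induct)
  case empty
  show ?case
    using ratfun_value_const[of 0 t] by (simp add: Zero_fract_def)
next
  case (infinite I)
  then show ?case
    using ratfun_value_const[of 0 t] by (simp add: Zero_fract_def)
qed (auto intro: ratfun_value_add)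

lemma sum_Fract_common:
  "finite I \<Longrightarrow> M \<noteq> 0 \<Longrightarrow> (\<Sum>i\<in>I. Fract (q i) M * Fract [:c i:] 1) = Fract (\<Sum>i\<in>I. Polynomial.smult (c i) (q i)) (M :: 'a::field poly)"
proof (induction I rule: finite_induct)
  case empty
  then show ?case
    by (simp add: Zero_fract_def eq_fract)
next
  case (insert i I)
  then show ?case
    by (simp add: eq_fract algebra_simps)
qed

lemma mobius_scale:
  assumes "c \<noteq> 0" "k \<noteq> 0"
  shows "mobius a b c d = mobius (a / k) (b / k) (c / k) (d / k)"
proof -
  have "Polynomial.smult k [:d / k, c / k:] = [:d, c:]" "Polynomial.smult k [:b / k, a / k:] = [:b, a:]"
    using assms by simp_all
  then have "[:b, a:] * [:d / k, c / k:] = [:b / k, a / k:] * [:d, c:]"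
    by (metis mult_smult_left mult_smult_right)
  then show ?thesis
    using assms by (simp add: mobius_def eq_fract)
qed

context subfield_of_type
begin

lemma ratfuns_common_denominator:
  assumes "finite I" "\<And>i. i \<in> I \<Longrightarrow> f i \<in> ratfuns_over S"
  shows "\<exists>M\<in>polys_over S. M \<noteq> 0 \<and> (\<exists>q. \<forall>i\<in>I. q i \<in> polys_over S \<and> f i = Fract (q i) M)"
  using assms
proof (induction I rule: finite_induct)
  case empty
  show ?case
    by (intro bexI[of _ 1]) (auto intro: polys)
next
  case (insert j I)
  then obtain M q where M: "M \<in> polys_over S" "M \<noteq> 0"
    "\<And>i. i \<in> I \<Longrightarrow> q i \<in> polys_over S \<and> f i = Fract (q i) M"
    by blast
  obtain p r where pr: "f j = Fract p r" "p \<in> polys_over S" "r \<in> polys_over S" "r \<noteq> 0"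
    using insert.prems[of j] by (auto simp: ratfuns_over_def)
  show ?case
  proof (intro bexI[of _ "M * r"] conjI exI[of _ "\<lambda>i. if i = j then p * M else q i * r"] ballI)
    fix i assume "i \<in> insert j I"
    then show "(if i = j then p * M else q i * r) \<in> polys_over S"
      using M pr by (auto intro: mult_polys)
    show "f i = Fract (if i = j then p * M else q i * r) (M * r)"
      using M pr \<open>i \<in> insert j I\<close> by (auto simp: eq_fract)
  qed (use M pr in \<open>auto intro: mult_polys\<close>)
qed

lemma ratfuns_diff:
  assumes "f \<in> ratfuns_over S" "g \<in> ratfuns_over S"
  shows "f - g \<in> ratfuns_over S"
proof -
  obtain p q p' q' where *: "f = Fract p q" "p \<in> polys_over S" "q \<in> polys_over S" "q \<noteq> 0"
    "g = Fract p' q'" "p' \<in> polys_over S" "q' \<in> polys_over S" "q' \<noteq> 0"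
    using assms unfolding ratfuns_over_def by blast
  then have "f - g = Fract (p * q' - p' * q) (q * q')"
    by simp
  with * show ?thesis
    unfolding ratfuns_over_def mem_Collect_eq
    by (intro exI[of _ "p * q' - p' * q"] exI[of _ "q * q'"]) (auto intro: mult_polys diff_polys)
qed

end

context power_basis
begin

lemma rep_sum:
  assumes "x \<in> L"
  obtains c where "\<And>i. c i \<in> K" "x = (\<Sum>i<n. c i * \<alpha> ^ i)"
proof -
  obtain p where p: "p \<in> polys_over K" "x = poly p \<alpha>" "p = 0 \<or> Polynomial.degree p < n"
    using ex_poly[OF assms] by blast
  have "x = (\<Sum>i<n. Polynomial.coeff p i * \<alpha> ^ i)"
  proof (cases "p = 0")
    case False
    then have "{..Polynomial.degree p} \<subseteq> {..<n}"
      using p(3) by auto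
    then show ?thesis
      unfolding p(2) poly_altdef by (intro sum.mono_neutral_left) (auto simp: Polynomial.coeff_eq_0)
  qed (use p in simp)
  with that K.coeff_mem[OF p(1)] show thesis by blast
qed

lemma sum_mem_L: "(\<And>i. i < n \<Longrightarrow> c i \<in> K) \<Longrightarrow> (\<Sum>i<n. c i * \<alpha> ^ i) \<in> L"
  using K_subset alpha_mem by (intro L.sum_mem L.mult_mem L.power_mem) auto

lemma indep_sum:
  assumes \<beta>: "poly minpoly \<beta> = 0" and c: "\<And>i. i < n \<Longrightarrow> c i \<in> K"
    and sum: "(\<Sum>i<n. c i * \<beta> ^ i) = 0" and "i < n"
  shows "c i = 0"
proof -
  define p where "p = (\<Sum>i<n. Polynomial.monom (c i) i)"
  have coeff: "Polynomial.coeff p j = (if j < n then c j else 0)" for j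
    by (simp add: p_def Polynomial.coeff_sum)
  have p: "p \<in> polys_over K"
    unfolding p_def using c by (intro K.sum_polys K.monom_polys) auto
  have "poly p \<beta> = 0"
    using sum by (simp add: p_def poly_sum poly_monom)
  then have "poly p \<alpha> = 0"
    using root_transfer_back[OF p _ \<beta>] by blast
  moreover have "Polynomial.degree p < n"
    using n_pos coeff by (intro Polynomial.degree_lessI) auto
  ultimately have "p = 0"
    using indep p by blast
  then show ?thesis
    using coeff[of i] \<open>i < n\<close> by simp
qed

lemma conjugate_map_sum:
  assumes \<beta>: "poly minpoly \<beta> = 0" and c: "\<And>i. i < n \<Longrightarrow> c i \<in> K"
  shows "conjugate_map \<beta> (\<Sum>i<n. c i * \<alpha> ^ i) = (\<Sum>i<n. c i * \<beta> ^ i)"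
proof -
  define p where "p = (\<Sum>i<n. Polynomial.monom (c i) i)"
  have "p \<in> polys_over K"
    unfolding p_def using c by (intro K.sum_polys K.monom_polys) auto
  from conjugate_map_poly[OF \<beta> this] show ?thesis
    by (simp add: p_def poly_sum poly_monom)
qed

lemma poly_decompose:
  assumes "Q \<in> polys_over L"
  obtains q where "\<And>i. q i \<in> polys_over K" "Q = (\<Sum>i<n. Polynomial.smult (\<alpha> ^ i) (q i))"
proof -
  have "\<exists>c. (\<forall>i. c i \<in> K) \<and> Polynomial.coeff Q k = (\<Sum>i<n. c i * \<alpha> ^ i)" for k
    using rep_sum[OF L.coeff_mem[OF assms], of k] by metis
  then obtain c where c: "\<And>k i. c k i \<in> K" "\<And>k. Polynomial.coeff Q k = (\<Sum>i<n. c k i * \<alpha> ^ i)"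
    by metis
  define q where "q i = (\<Sum>k\<le>Polynomial.degree Q. Polynomial.monom (c k i) k)" for i
  show thesis
  proof (rule that)
    show "q i \<in> polys_over K" for i
      unfolding q_def using c by (intro K.sum_polys K.monom_polys)
    show "Q = (\<Sum>i<n. Polynomial.smult (\<alpha> ^ i) (q i))"
    proof (rule poly_eqI)
      fix k
      have "Polynomial.coeff (\<Sum>i<n. Polynomial.smult (\<alpha> ^ i) (q i)) k
          = (\<Sum>i<n. (if k \<le> Polynomial.degree Q then c k i else 0) * \<alpha> ^ i)"
        by (simp add: Polynomial.coeff_sum q_def mult.commute)
      also have "\<dots> = Polynomial.coeff Q k"
        by (cases "k \<le> Polynomial.degree Q") (simp_all add: c(2)[of k, symmetric] Polynomial.coeff_eq_0)
      finally show "Polynomial.coeff Q k = Polynomial.coeff (\<Sum>i<n. Polynomial.smult (\<alpha> ^ i) (q i)) k" ..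
    qed
  qed
qed

definition is_components :: "'f poly fract vec \<Rightarrow> 'f poly fract \<Rightarrow> bool" where
  "is_components \<phi> u \<longleftrightarrow> \<phi> \<in> carrier_vec n \<and> (\<forall>i<n. \<phi> $ i \<in> ratfuns_over K) \<and>
     u = (\<Sum>i<n. \<phi> $ i * Fract [:\<alpha> ^ i:] 1)"

lemma is_components_unique:
  assumes "is_components \<phi> u" "is_components \<psi> u"
  shows "\<phi> = \<psi>"
proof -
  have "\<exists>M\<in>polys_over K. M \<noteq> 0 \<and> (\<exists>q. \<forall>i\<in>{..<n}. q i \<in> polys_over K \<and> \<phi> $ i - \<psi> $ i = Fract (q i) M)"
    using assms by (intro K.ratfuns_common_denominator K.ratfuns_diff) (auto simp: is_components_def)
  then obtain M q where M: "M \<in> polys_over K" "M \<noteq> 0"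
    and q: "\<And>i. i < n \<Longrightarrow> q i \<in> polys_over K" "\<And>i. i < n \<Longrightarrow> \<phi> $ i - \<psi> $ i = Fract (q i) M"
    by auto
  have "0 = (\<Sum>i<n. (\<phi> $ i - \<psi> $ i) * Fract [:\<alpha> ^ i:] 1)"
    using assms by (simp add: is_components_def left_diff_distrib sum_subtractf)
  also have "\<dots> = (\<Sum>i<n. Fract (q i) M * Fract [:\<alpha> ^ i:] 1)"
    using q by (intro sum.cong) auto
  also have "\<dots> = Fract (\<Sum>i<n. Polynomial.smult (\<alpha> ^ i) (q i)) M"
    using M(2) by (intro sum_Fract_common) simp_all
  finally have zero: "(\<Sum>i<n. Polynomial.smult (\<alpha> ^ i) (q i)) = 0"
    using M(2) by (simp add: Zero_fract_def eq_fract)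
  have "q i = 0" if "i < n" for i
  proof (rule poly_eqI)
    fix k
    have sum: "(\<Sum>i<n. Polynomial.coeff (q i) k * \<alpha> ^ i) = 0"
      using arg_cong[OF zero, of "\<lambda>p. Polynomial.coeff p k"] by (simp add: Polynomial.coeff_sum mult.commute)
    have mem: "Polynomial.coeff (q j) k \<in> K" if "j < n" for j
      using q(1)[OF that] by (rule K.coeff_mem)
    have "Polynomial.coeff (q i) k = 0"
      using indep_sum[OF minpoly(4), of "\<lambda>j. Polynomial.coeff (q j) k" i, OF mem sum that] .
    then show "Polynomial.coeff (q i) k = Polynomial.coeff 0 k"
      by simp
  qed
  then have "\<phi> $ i = \<psi> $ i" if "i < n" for i
    using q(2)[OF that] that M(2) by (simp add: Zero_fract_def[symmetric] fract_collapse)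
  then show ?thesis
    using assms by (intro eq_vecI) (auto simp: is_components_def)
qed

lemma unit_components_eqI: "is_components \<phi> u \<Longrightarrow> unit_components K \<alpha> n u = \<phi>"
  unfolding unit_components_def is_components_def[symmetric]
  using is_components_unique by blast

lemma is_components_Fract:
  assumes "M \<in> polys_over K" "M \<noteq> 0" "\<And>i. i < n \<Longrightarrow> q i \<in> polys_over K"
  shows "is_components (vec n (\<lambda>i. Fract (q i) M)) (Fract (\<Sum>i<n. Polynomial.smult (\<alpha> ^ i) (q i)) M)"
proof -
  have "(\<Sum>i<n. vec n (\<lambda>i. Fract (q i) M) $ i * Fract [:\<alpha> ^ i:] 1) = (\<Sum>i<n. Fract (q i) M * Fract [:\<alpha> ^ i:] 1)"
    by (intro sum.cong) auto
  also have "\<dots> = Fract (\<Sum>i<n. Polynomial.smult (\<alpha> ^ i) (q i)) M"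
    using assms(2) by (intro sum_Fract_common) simp
  finally show ?thesis
    using assms unfolding is_components_def ratfuns_over_def by auto
qed

lemma multiple_over_K:
  assumes "c \<in> L" "d \<in> L" "c \<noteq> 0 \<or> d \<noteq> 0"
  obtains M R where "M \<in> polys_over K" "M \<noteq> 0" "R \<in> polys_over L" "M = [:d, c:] * R"
proof (cases "c = 0")
  case True
  show thesis
  proof (rule that)
    show "1 \<in> polys_over K" "[:1 / d:] \<in> polys_over L"
      using assms by (auto simp: L.pCons_polys intro: K.polys L.polys L.mem)
    show "1 = [:d, c:] * [:1 / d:]"
      using True assms by (simp add: one_pCons)
  qed simp
next
  case False
  obtain M where M: "M \<in> polys_over K" "M \<noteq> 0" "poly M (- d / c) = 0"
    using algebraic by blast
  have "M \<in> polys_over L" "[:d, c:] \<in> polys_over L"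
    using M(1) K_subset assms by (auto simp: polys_over_def L.mem coeff_pCons split: nat.split)
  then obtain k r where kr: "k \<in> polys_over L" "M = [:d, c:] * k + r"
    "r = 0 \<or> Polynomial.degree r < Polynomial.degree [:d, c:]"
    by (rule L.polys_division[of M "[:d, c:]"]) (use False in auto)
  have "poly r (- d / c) = 0"
    using kr(2) M(3) False by simp
  moreover have "Polynomial.degree r = 0"
    using kr(3) False by auto
  ultimately have "r = 0"
    by (auto elim: degree_eq_zeroE)
  then show thesis
    using that M kr by simp
qed

lemma unit_components:
  assumes L: "a \<in> L" "b \<in> L" "c \<in> L" "d \<in> L" and det: "a * d - b * c \<noteq> 0"
  obtains M q where "M \<in> polys_over K" "M \<noteq> 0" "\<And>i. q i \<in> polys_over K"
    "unit_components K \<alpha> n (mobius a b c d) = vec n (\<lambda>i. Fract (q i) M)"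
    "[:d, c:] * (\<Sum>i<n. Polynomial.smult (\<alpha> ^ i) (q i)) = [:b, a:] * M"
proof -
  have cd: "c \<noteq> 0 \<or> d \<noteq> 0" using det by auto
  obtain M R where M: "M \<in> polys_over K" "M \<noteq> 0" "R \<in> polys_over L" "M = [:d, c:] * R"
    using multiple_over_K[OF L(3,4) cd] .
  have "[:b, a:] * R \<in> polys_over L"
    using L M by (intro L.mult_polys) (auto simp: L.pCons_polys L.zero_polys)
  then obtain q where q: "\<And>i. q i \<in> polys_over K" "[:b, a:] * R = (\<Sum>i<n. Polynomial.smult (\<alpha> ^ i) (q i))"
    using poly_decompose by blast
  have eq: "[:d, c:] * (\<Sum>i<n. Polynomial.smult (\<alpha> ^ i) (q i)) = [:b, a:] * M"
    unfolding q(2)[symmetric] M(4) by (simp only: mult.left_commute)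
  have "mobius a b c d = Fract (\<Sum>i<n. Polynomial.smult (\<alpha> ^ i) (q i)) M"
    using eq cd M(2) by (auto simp: mobius_def eq_fract mult.commute simp del: mult_pCons_left mult_pCons_right)
  then have "unit_components K \<alpha> n (mobius a b c d) = vec n (\<lambda>i. Fract (q i) M)"
    using is_components_Fract[OF M(1,2)] q(1) by (metis unit_components_eqI)
  with that M q eq show thesis by blast
qed

lemma conjugate_components:
  assumes L: "a \<in> L" "b \<in> L" "c \<in> L" "d \<in> L"
    and \<beta>: "poly minpoly \<beta> = 0"
    and MK: "M \<in> polys_over K" and qK: "\<And>i. q i \<in> polys_over K"
    and eq: "[:d, c:] * (\<Sum>i<n. Polynomial.smult (\<alpha> ^ i) (q i)) = [:b, a:] * M"
  defines "\<sigma> \<equiv> conjugate_map \<beta>"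
  shows "[:\<sigma> d, \<sigma> c:] * (\<Sum>i<n. Polynomial.smult (\<beta> ^ i) (q i)) = [:\<sigma> b, \<sigma> a:] * M"
proof (rule poly_eqI)
  fix k
  define s where "s j = (\<Sum>i<n. Polynomial.coeff (q i) j * \<alpha> ^ i)" for j
  define s' where "s' j = (\<Sum>i<n. Polynomial.coeff (q i) j * \<beta> ^ i)" for j
  have s: "Polynomial.coeff (\<Sum>i<n. Polynomial.smult (\<alpha> ^ i) (q i)) j = s j" for j
    by (simp add: Polynomial.coeff_sum s_def mult.commute)
  have s': "Polynomial.coeff (\<Sum>i<n. Polynomial.smult (\<beta> ^ i) (q i)) j = s' j" for j
    by (simp add: Polynomial.coeff_sum s'_def mult.commute)
  have sL: "s j \<in> L" for j
    unfolding s_def using K.coeff_mem[OF qK] by (intro sum_mem_L)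
  have \<sigma>s: "\<sigma> (s j) = s' j" for j
    unfolding s_def s'_def \<sigma>_def using K.coeff_mem[OF qK] by (intro conjugate_map_sum[OF \<beta>])
  have Mj: "Polynomial.coeff M j \<in> L" "\<sigma> (Polynomial.coeff M j) = Polynomial.coeff M j" for j
    using K.coeff_mem[OF MK] K_subset conjugate_map_base[OF \<beta>] by (auto simp: \<sigma>_def)
  have k: "Polynomial.coeff ([:d, c:] * (\<Sum>i<n. Polynomial.smult (\<alpha> ^ i) (q i))) k = Polynomial.coeff ([:b, a:] * M) k"
    by (simp only: eq)
  have add: "\<sigma> (x + y) = \<sigma> x + \<sigma> y" and mult: "\<sigma> (x * y) = \<sigma> x * \<sigma> y" if "x \<in> L" "y \<in> L" for x y
    using conjugate_map_add[OF \<beta> that] conjugate_map_mult[OF \<beta> that] by (simp_all add: \<sigma>_def)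
  show "Polynomial.coeff ([:\<sigma> d, \<sigma> c:] * (\<Sum>i<n. Polynomial.smult (\<beta> ^ i) (q i))) k = Polynomial.coeff ([:\<sigma> b, \<sigma> a:] * M) k"
  proof (cases k)
    case 0
    then have "d * s 0 = b * Polynomial.coeff M 0"
      using k s[of 0] by simp
    then have "\<sigma> d * s' 0 = \<sigma> b * Polynomial.coeff M 0"
      using mult L sL Mj \<sigma>s by metis
    then show ?thesis
      using 0 s'[of 0] by simp
  next
    case (Suc j)
    then have "d * s (Suc j) + c * s j = b * Polynomial.coeff M (Suc j) + a * Polynomial.coeff M j"
      using k s by simp
    then have "\<sigma> (d * s (Suc j) + c * s j) = \<sigma> (b * Polynomial.coeff M (Suc j) + a * Polynomial.coeff M j)"
      by simp
    then have "\<sigma> d * s' (Suc j) + \<sigma> c * s' j = \<sigma> b * Polynomial.coeff M (Suc j) + \<sigma> a * Polynomial.coeff M j"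
      using L sL Mj by (simp add: add mult \<sigma>s L.mult_mem)
    then show ?thesis
      using Suc s' by simp
  qed
qed

end

section \<open>Closures and local parametrizations\<close>

interpretation id_hom: comm_ring_hom "id :: 'a::comm_ring_1 \<Rightarrow> 'a"
  by unfold_locales auto

interpretation fps_const_hom: comm_ring_hom "fps_const :: 'a::comm_ring_1 \<Rightarrow> 'a fps"
  by unfold_locales (auto simp: fps_const_add[symmetric] fps_const_mult[symmetric] simp del: fps_const_add fps_const_mult)

lemma poly_mpoly_eval:
  assumes "x \<in> carrier_vec N" "P \<in> mpolys N"
  shows "poly (mpoly_eval (\<lambda>c. [:c:]) x P) t = mpoly_eval id (map_vec (\<lambda>p. poly p (t :: 'a::comm_ring_1)) x) P"
proof -
  have hom: "comm_ring_hom (\<lambda>p. poly p t)"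
    by unfold_locales auto
  show ?thesis
    using mpoly_eval_hom[OF hom assms, of "\<lambda>c. [:c:]"] by (simp add: comp_def id_def)
qed

lemma fps_mpoly_eval_expansion:
  assumes "x \<in> carrier_vec N" "P \<in> mpolys N"
  shows "fps_of_poly (pcompose (mpoly_eval (\<lambda>c. [:c:]) x P) [:t, 1:])
      = mpoly_eval fps_const (map_vec (\<lambda>p. fps_of_poly (pcompose p [:t :: 'a::field_char_0, 1:])) x) P"
proof -
  have hom: "comm_ring_hom (\<lambda>p. fps_of_poly (pcompose p [:t, 1:]))"
    by unfold_locales
      (auto simp: pcompose_add pcompose_mult pcompose_1 fps_of_poly_add fps_of_poly_mult pcompose_uminus)
  show ?thesis
    using mpoly_eval_hom[OF hom assms, of "\<lambda>c. [:c:]"] by (simp add: comp_def fps_of_poly_const)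
qed

lemma zariski_closureD:
  "x \<in> zariski_closure n A \<Longrightarrow> P \<in> mpolys n \<Longrightarrow> (\<And>y. y \<in> A \<Longrightarrow> mpoly_eval id y P = 0) \<Longrightarrow> mpoly_eval id x P = 0"
  by (auto simp: zariski_closure_def)

lemma zariski_closure_subset: "A \<subseteq> carrier_vec n \<Longrightarrow> A \<subseteq> zariski_closure n A"
  by (auto simp: zariski_closure_def)

lemma zariski_closure_carrier: "zariski_closure n A \<subseteq> carrier_vec n"
  by (auto simp: zariski_closure_def)

lemma vCons_carrier: "y \<in> carrier_vec n \<Longrightarrow> vCons c y \<in> carrier_vec (Suc n)"
  by (metis carrier_vecD carrier_vecI dim_vec_vCons)

lemma vanishes_projective_closure_iff:
  assumes "U \<subseteq> carrier_vec n" "P \<in> mpolys (Suc n)" "homogeneous P"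
  shows "(\<forall>x\<in>projective_closure n U. mpoly_eval id x P = 0) \<longleftrightarrow> (\<forall>y\<in>U. mpoly_eval id (vCons 1 y) P = 0)"
proof
  assume *: "\<forall>x\<in>projective_closure n U. mpoly_eval id x P = 0"
  show "\<forall>y\<in>U. mpoly_eval id (vCons 1 y) P = 0"
  proof
    fix y assume "y \<in> U"
    moreover have "vCons 1 y \<noteq> 0\<^sub>v (Suc n)"
      by (metis index_zero_vec(1) vec_index_vCons_0 zero_less_Suc zero_neq_one)
    ultimately have "vCons 1 y \<in> projective_closure n U"
      using assms(1) by (auto simp: projective_closure_def intro: vCons_carrier)
    with * show "mpoly_eval id (vCons 1 y) P = 0" by blast
  qed
qed (use assms in \<open>auto simp: projective_closure_def\<close>)

lemma local_paramD:
  assumes "local_param S n (projective_closure n U) a" "U \<subseteq> carrier_vec n" "P \<in> forms (Suc n) d"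
    "\<And>y. y \<in> U \<Longrightarrow> mpoly_eval id (vCons 1 y) P = 0"
  shows "mpoly_eval fps_const a P = 0"
  using assms vanishes_projective_closure_iff[OF assms(2) forms_mpolys[OF assms(3)] forms_homogeneous[OF assms(3)]]
    forms_mpolys[OF assms(3)] forms_homogeneous[OF assms(3)]
  unfolding local_param_def by blast

lemma expansion_vanishes:
  fixes U :: "'f::field_char_0 vec set"
  assumes U: "U \<subseteq> carrier_vec n" and p: "p \<in> carrier_vec (Suc n)"
    and inf: "infinite {t. poly (p $ 0) t \<noteq> 0 \<and> vec n (\<lambda>i. poly (p $ Suc i) t / poly (p $ 0) t) \<in> U}"
    and P: "P \<in> mpolys (Suc n)" "homogeneous P" "\<forall>x\<in>projective_closure n U. mpoly_eval id x P = 0"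
  shows "mpoly_eval fps_const (map_vec (\<lambda>q. fps_of_poly (pcompose q [:t0, 1:])) p) P = 0"
proof -
  let ?q = "mpoly_eval (\<lambda>c. [:c:]) p P"
  obtain d where d: "\<And>m. m \<in> Poly_Mapping.keys P \<Longrightarrow> total_degree m = d"
    using homogeneousE[OF P(2)] by blast
  have root: "poly ?q t = 0"
    if t: "poly (p $ 0) t \<noteq> 0" "vec n (\<lambda>i. poly (p $ Suc i) t / poly (p $ 0) t) \<in> U" for t
  proof -
    let ?y = "vec n (\<lambda>i. poly (p $ Suc i) t / poly (p $ 0) t)"
    have "map_vec (\<lambda>q. poly q t) p = poly (p $ 0) t \<cdot>\<^sub>v vCons 1 ?y"
    proof (rule eq_vecI)
      fix i assume "i < dim_vec (poly (p $ 0) t \<cdot>\<^sub>v vCons 1 ?y)"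
      then have "i < Suc n" by simp
      then show "map_vec (\<lambda>q. poly q t) p $ i = (poly (p $ 0) t \<cdot>\<^sub>v vCons 1 ?y) $ i"
        using p t by (cases i) auto
    qed (use p in auto)
    then have "poly ?q t = poly (p $ 0) t ^ d * mpoly_eval id (vCons 1 ?y) P"
      using mpoly_eval_smult[OF vCons_carrier[of ?y n 1] P(1) d, of id "poly (p $ 0) t"]
      by (simp add: poly_mpoly_eval[OF p P(1)])
    also have "mpoly_eval id (vCons 1 ?y) P = 0"
      using P t(2) vanishes_projective_closure_iff[OF U P(1,2)] by blast
    finally show ?thesis by simp
  qed
  have "infinite {t. poly ?q t = 0}"
    by (rule infinite_super[OF _ inf]) (use root in auto)
  then have "?q = 0"
    using poly_roots_finite by blast
  then show ?thesis
    using fps_mpoly_eval_expansion[OF p P(1), of t0] by simp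
qed

lemma reducible_paramE:
  assumes "reducible_param S n V a"
  obtains b \<rho> G where "local_param S n V b" "fps_nth \<rho> 0 \<noteq> 0" "fps_nth G 0 = 0" "subdegree G \<ge> 2"
    "a = \<rho> \<cdot>\<^sub>v map_vec (\<lambda>f. fps_compose f G) b"
proof -
  obtain b r T \<rho> where *: "local_param S n V b" "r \<ge> 2" "fps_nth T 0 = 0" "fps_nth T 1 \<noteq> 0" "fps_nth \<rho> 0 \<noteq> 0"
    "a = \<rho> \<cdot>\<^sub>v map_vec (\<lambda>f. fps_compose f T) (map_vec (\<lambda>f. fps_compose f (fps_X ^ r)) b)"
    using assms unfolding reducible_param_def param_equiv_def by blast
  have "subdegree T = 1"
    using * by (intro subdegreeI) (auto simp: less_Suc_eq)
  then have "subdegree (T ^ r) \<ge> 2" "fps_nth (T ^ r) 0 = 0"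
    using * by (simp_all add: subdegree_power)
  moreover have "a = \<rho> \<cdot>\<^sub>v map_vec (\<lambda>f. fps_compose f (T ^ r)) b"
    using * by (intro eq_vecI) (simp_all add: fps_compose_assoc[symmetric] fps_compose_power[symmetric])
  ultimately show thesis
    using that * by blast
qed

section \<open>Lines\<close>

lemma nonzero_vec_index:
  assumes "a \<in> carrier_vec n" "a \<noteq> 0\<^sub>v n"
  obtains k where "k < n" "a $ k \<noteq> 0"
  using assms by (metis carrier_vecD eq_vecI index_zero_vec)

lemma zariski_closure_line:
  fixes a b :: "'f::field_char_0 vec"
  assumes ab: "a \<in> carrier_vec n" "b \<in> carrier_vec n" "a \<noteq> 0\<^sub>v n"
    and A: "A \<subseteq> {b + s \<cdot>\<^sub>v a | s. True}" "infinite {s. b + s \<cdot>\<^sub>v a \<in> A}"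
  shows "zariski_closure n A = {b + s \<cdot>\<^sub>v a | s. True}"
proof (intro equalityI subsetI)
  fix x assume x: "x \<in> zariski_closure n A"
  then have xc: "x \<in> carrier_vec n"
    using zariski_closure_carrier by blast
  obtain k where k: "k < n" "a $ k \<noteq> 0"
    using nonzero_vec_index[OF ab(1,3)] .
  let ?X = "\<lambda>i. Poly_Mapping.single (Poly_Mapping.single i 1) 1 :: 'f mpoly"
  let ?c = "\<lambda>c. Poly_Mapping.single 0 c :: 'f mpoly"
  have eq: "a $ k * (x $ i - b $ i) = a $ i * (x $ k - b $ k)" if "i < n" for i
  proof -
    let ?P = "?c (a $ k) * (?X i - ?c (b $ i)) - ?c (a $ i) * (?X k - ?c (b $ k))"
    have "mpoly_eval id x ?P = 0"
    proof (rule zariski_closureD[OF x])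
      show "?P \<in> mpolys n"
        using that k by (intro mpolys_diff mpolys_mult mpolys_const mpolys_var)
      fix y assume "y \<in> A"
      then show "mpoly_eval id y ?P = 0"
        using A(1) ab that k by (auto simp: algebra_simps)
    qed
    then show ?thesis by simp
  qed
  define s where "s = (x $ k - b $ k) / a $ k"
  have "x = b + s \<cdot>\<^sub>v a"
  proof (rule eq_vecI)
    fix i assume "i < dim_vec (b + s \<cdot>\<^sub>v a)"
    then have "i < n" using ab by simp
    then show "x $ i = (b + s \<cdot>\<^sub>v a) $ i"
      using eq[of i] k ab by (simp add: s_def field_simps)
  qed (use xc ab in auto)
  then show "x \<in> {b + s \<cdot>\<^sub>v a | s. True}" by blast
next
  fix x assume "x \<in> {b + s \<cdot>\<^sub>v a | s. True}"
  then obtain s where s: "x = b + s \<cdot>\<^sub>v a" by blast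
  define l where "l = vec n (\<lambda>i. [:b $ i, a $ i:])"
  have l: "l \<in> carrier_vec n" "\<And>t. map_vec (\<lambda>p. poly p t) l = b + t \<cdot>\<^sub>v a"
    using ab by (auto simp: l_def intro!: eq_vecI)
  have "mpoly_eval id x P = 0" if P: "P \<in> mpolys n" "\<forall>y\<in>A. mpoly_eval id y P = 0" for P
  proof -
    let ?q = "mpoly_eval (\<lambda>c. [:c:]) l P"
    have *: "poly ?q t = mpoly_eval id (b + t \<cdot>\<^sub>v a) P" for t
      using poly_mpoly_eval[OF l(1) P(1)] l(2) by simp
    have "infinite {t. poly ?q t = 0}"
      using P(2) by (intro infinite_super[OF _ A(2)]) (auto simp: *)
    then have "?q = 0"
      using poly_roots_finite by blast
    then show ?thesis
      using *[of s] s by simp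
  qed
  then show "x \<in> zariski_closure n A"
    using s ab by (simp add: zariski_closure_def)
qed

context subfield_char_0
begin

definition line_param :: "nat \<Rightarrow> 'a vec \<Rightarrow> 'a vec \<Rightarrow> 'a \<Rightarrow> 'a fps vec" where
  "line_param n b a c = vCons (fps_const c * fps_X)
     (vec n (\<lambda>i. fps_const (c * b $ i) * fps_X + fps_const (a $ i)))"

context
  fixes n :: nat and a b :: "'a vec"
  assumes ab: "a \<in> carrier_vec n" "b \<in> carrier_vec n" "a \<noteq> 0\<^sub>v n"
    and S: "\<And>i. i < n \<Longrightarrow> a $ i \<in> S" "\<And>i. i < n \<Longrightarrow> b $ i \<in> S"
begin

abbreviation "U \<equiv> {b + s \<cdot>\<^sub>v a | s. True}"

lemma U_carrier: "U \<subseteq> carrier_vec n"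
  using ab by auto

lemma line_param_local:
  assumes c: "c \<in> S" "c \<noteq> 0"
  shows "local_param S n (projective_closure n U) (line_param n b a c)"
proof -
  obtain k where k: "k < n" "a $ k \<noteq> 0"
    using nonzero_vec_index[OF ab(1,3)] .
  define p where "p = vCons [:0, c:] (vec n (\<lambda>i. [:a $ i, c * b $ i:]))"
  have p: "p \<in> carrier_vec (Suc n)"
    by (simp add: p_def vCons_carrier)
  have lp: "line_param n b a c = map_vec (\<lambda>q. fps_of_poly (pcompose q [:0, 1:])) p"
  proof (rule eq_vecI)
    fix i assume "i < dim_vec (map_vec (\<lambda>q. fps_of_poly (pcompose q [:0, 1:])) p)"
    then have "i < Suc n" using p by simp
    then show "line_param n b a c $ i = map_vec (\<lambda>q. fps_of_poly (pcompose q [:0, 1:])) p $ i"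
      by (cases i) (simp_all add: line_param_def p_def fps_of_poly_pCons algebra_simps)
  qed (simp add: line_param_def p_def)
  show ?thesis
    unfolding local_param_def
  proof (intro conjI ballI allI impI)
    show "line_param n b a c \<in> carrier_vec (Suc n)"
      by (simp add: line_param_def vCons_carrier)
    show "line_param n b a c $ i \<in> fps_over S" if "i \<le> n" for i
      using that c S
      by (cases i) (auto simp: line_param_def intro!: fps_over_add fps_over_mult fps_over_const fps_over_X mem)
    show "\<exists>i\<le>n. fps_nth (line_param n b a c $ i) 0 \<noteq> 0"
      using k by (intro exI[of _ "Suc k"]) (simp add: line_param_def)
    show "mpoly_eval fps_const (line_param n b a c) P = 0"
      if P: "P \<in> mpolys (Suc n)" "homogeneous P" "\<forall>x\<in>projective_closure n U. mpoly_eval id x P = 0" for P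
      unfolding lp
    proof (rule expansion_vanishes[OF U_carrier p _ P])
      have "- {0} \<subseteq> {t. poly (p $ 0) t \<noteq> 0 \<and> vec n (\<lambda>i. poly (p $ Suc i) t / poly (p $ 0) t) \<in> U}"
      proof
        fix t :: 'a assume t: "t \<in> - {0}"
        then have "vec n (\<lambda>i. poly (p $ Suc i) t / poly (p $ 0) t) = b + (1 / (t * c)) \<cdot>\<^sub>v a"
          using ab c by (intro eq_vecI) (auto simp: p_def field_simps)
        with t c show "t \<in> {t. poly (p $ 0) t \<noteq> 0 \<and> vec n (\<lambda>i. poly (p $ Suc i) t / poly (p $ 0) t) \<in> U}"
          by (auto simp: p_def)
      qed
      moreover have "infinite (- {0 :: 'a})"
        using infinite_UNIV_char_0 by (simp add: Compl_eq_Diff_UNIV)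
      ultimately show "infinite {t. poly (p $ 0) t \<noteq> 0 \<and> vec n (\<lambda>i. poly (p $ Suc i) t / poly (p $ 0) t) \<in> U}"
        by (rule infinite_super)
    qed
    show "\<not> (\<exists>\<rho>. \<exists>d\<in>carrier_vec (Suc n). line_param n b a c = \<rho> \<cdot>\<^sub>v map_vec fps_const d)"
    proof clarify
      fix \<rho> d assume d: "d \<in> carrier_vec (Suc n)" "line_param n b a c = \<rho> \<cdot>\<^sub>v map_vec fps_const d"
      have i: "fps_nth (line_param n b a c $ i) j = fps_nth \<rho> j * d $ i" if "i < Suc n" for i j
        using d that by simp
      have "fps_nth \<rho> 0 * d $ 0 = 0" "fps_nth \<rho> 1 * d $ 0 = c"
        using i[of 0 0] i[of 0 1] by (simp_all add: line_param_def)
      then have "fps_nth \<rho> 0 = 0"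
        using c by auto
      then show False
        using i[of "Suc k" 0] k by (simp add: line_param_def)
    qed
  qed
qed

lemma line_param_irreducible:
  assumes c: "c \<in> S" "c \<noteq> 0"
  shows "\<not> reducible_param S n (projective_closure n U) (line_param n b a c)"
proof
  assume "reducible_param S n (projective_closure n U) (line_param n b a c)"
  then obtain f \<rho> G where *: "local_param S n (projective_closure n U) f" "fps_nth \<rho> 0 \<noteq> 0"
    "fps_nth G 0 = 0" "subdegree G \<ge> 2" "line_param n b a c = \<rho> \<cdot>\<^sub>v map_vec (\<lambda>f. fps_compose f G) f"
    by (rule reducible_paramE)
  have "dim_vec f = Suc n"
    using *(1) by (simp add: local_param_def)
  then have "fps_const c * fps_X = \<rho> * fps_compose (f $ 0) G"
    using arg_cong[OF *(5), of "\<lambda>x. x $ 0"] by (simp add: line_param_def)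
  then have eq: "subdegree (fps_const c * fps_X) = subdegree (\<rho> * fps_compose (f $ 0) G)"
    and nz: "\<rho> * fps_compose (f $ 0) G \<noteq> 0"
    using c by auto
  have "subdegree \<rho> = 0"
    using *(2) by simp
  then have "1 = subdegree (f $ 0) * subdegree G"
    using eq nz c *(3) by simp
  then show False
    using *(4) by simp
qed

lemma line_param_unique:
  assumes f: "local_param S n (projective_closure n U) f"
    "\<not> reducible_param S n (projective_closure n U) f" "fps_nth (f $ 0) 0 = 0"
  shows "param_equiv S (line_param n b a 1) f"
proof -
  obtain k where k: "k < n" "a $ k \<noteq> 0"
    using nonzero_vec_index[OF ab(1,3)] .
  have fc: "f \<in> carrier_vec (Suc n)" and fS: "\<And>i. i \<le> n \<Longrightarrow> f $ i \<in> fps_over S"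
    using f(1) by (auto simp: local_param_def)
  let ?X = "\<lambda>i. Poly_Mapping.single (Poly_Mapping.single i 1) 1 :: 'a mpoly"
  let ?c = "\<lambda>c. Poly_Mapping.single 0 c :: 'a mpoly"
  have eq: "fps_const (a $ k) * (f $ Suc i - fps_const (b $ i) * f $ 0)
      = fps_const (a $ i) * (f $ Suc k - fps_const (b $ k) * f $ 0)" if "i < n" for i
  proof -
    let ?P = "?c (a $ k) * (?X (Suc i) - ?c (b $ i) * ?X 0) - ?c (a $ i) * (?X (Suc k) - ?c (b $ k) * ?X 0)"
    have "mpoly_eval fps_const f ?P = 0"
    proof (rule local_paramD[OF f(1) U_carrier])
      show "?P \<in> forms (Suc n) 1"
        using that k by (intro forms_diff forms_scale forms_var) auto
      fix y assume "y \<in> U"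
      then show "mpoly_eval id (vCons 1 y) ?P = 0"
        using ab that k by (auto simp: algebra_simps)
    qed
    then show ?thesis by simp
  qed
  define h where "h = fps_const (1 / a $ k) * (f $ Suc k - fps_const (b $ k) * f $ 0)"
  have hS: "h \<in> fps_over S"
    unfolding h_def using S k
    by (intro fps_over_mult fps_over_diff fps_over_const fS divide_mem one_mem) auto
  have fi: "f $ Suc i = fps_const (b $ i) * f $ 0 + fps_const (a $ i) * h" if "i < n" for i
  proof -
    have cancel: "fps_const (1 / a $ k) * (fps_const (a $ k) * g) = g" for g
      using k(2) by (simp flip: mult.assoc)
    have "fps_const (1 / a $ k) * (fps_const (a $ k) * (f $ Suc i - fps_const (b $ i) * f $ 0))
        = fps_const (a $ i) * h"
      unfolding eq[OF that] h_def by (simp only: mult.left_commute)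
    then show ?thesis
      by (simp only: cancel diff_eq_eq add.commute)
  qed
  have h0: "fps_nth h 0 \<noteq> 0"
  proof
    assume h0: "fps_nth h 0 = 0"
    obtain i where i: "i \<le> n" "fps_nth (f $ i) 0 \<noteq> 0"
      using f(1) by (auto simp: local_param_def)
    then obtain j where "i = Suc j"
      using f(3) by (cases i) auto
    then show False
      using i fi[of j] h0 f(3) by simp
  qed
  define T where "T = f $ 0 * inverse h"
  have TS: "T \<in> fps_over S"
    unfolding T_def using hS h0 by (intro fps_over_mult fS fps_over_inverse) auto
  have T0: "fps_nth T 0 = 0"
    using f(3) by (simp add: T_def)
  have hT: "h * T = f $ 0"
    using h0 by (simp add: T_def mult.left_commute inverse_mult_eq_1')
  have f_eq: "f = h \<cdot>\<^sub>v vCons T (vec n (\<lambda>i. fps_const (b $ i) * T + fps_const (a $ i)))"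
  proof (rule eq_vecI)
    fix i assume "i < dim_vec (h \<cdot>\<^sub>v vCons T (vec n (\<lambda>i. fps_const (b $ i) * T + fps_const (a $ i))))"
    then have "i < Suc n" by simp
    then show "f $ i = (h \<cdot>\<^sub>v vCons T (vec n (\<lambda>i. fps_const (b $ i) * T + fps_const (a $ i)))) $ i"
      using fi by (cases i) (simp_all add: hT[symmetric] algebra_simps)
  qed (use fc in simp)
  have comp: "map_vec (\<lambda>f. fps_compose f G) (line_param n b a c)
      = vCons (fps_const c * G) (vec n (\<lambda>i. fps_const (b $ i) * (fps_const c * G) + fps_const (a $ i)))"
    if "fps_nth G 0 = 0" for G c
  proof (rule eq_vecI)
    fix i assume "i < dim_vec (vCons (fps_const c * G) (vec n (\<lambda>i. fps_const (b $ i) * (fps_const c * G) + fps_const (a $ i))))"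
    then have i: "i < Suc n" by simp
    have "fps_const (c * b $ j) * G = fps_const (b $ j) * (fps_const c * G)" for j
      by (simp only: mult.assoc[symmetric] fps_const_mult mult.commute[of c])
    with i show "map_vec (\<lambda>f. fps_compose f G) (line_param n b a c) $ i
      = vCons (fps_const c * G) (vec n (\<lambda>i. fps_const (b $ i) * (fps_const c * G) + fps_const (a $ i))) $ i"
      using that by (cases i) (simp_all add: line_param_def fps_compose_add_distrib fps_compose_mult_distrib)
  qed (simp add: line_param_def)
  have T_nz: "T \<noteq> 0"
  proof
    assume "T = 0"
    then have "f = h \<cdot>\<^sub>v map_vec fps_const (vCons 0 a)"
      unfolding f_eq using ab by (intro eq_vecI) (auto simp: less_Suc_eq_0_disj)
    then show False
      using f(1) ab vCons_carrier[of a n 0] unfolding local_param_def by blast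
  qed
  define m where "m = subdegree T"
  have m: "m > 0"
    using T_nz T0 by (simp add: m_def subdegree_eq_0_iff neq0_conv[symmetric])
  have "m = 1"
  proof (rule ccontr)
    assume "m \<noteq> 1"
    with m have m2: "m \<ge> 2" by simp
    define c where "c = fps_nth T m"
    have c: "c \<in> S" "c \<noteq> 0"
      using TS T_nz by (simp_all add: c_def m_def fps_nth_mem)
    define v where "v = fps_const (1 / c) * fps_shift m T"
    have v: "v \<in> fps_over S" "fps_nth v 0 = 1"
      using TS c by (auto simp: v_def c_def fps_over_def intro!: mem)
    obtain w where w: "w \<in> fps_over S" "fps_nth w 0 = 1" "w ^ m = v"
      using fps_over_root[OF v m] .
    define W where "W = fps_X * w"
    have W: "W \<in> fps_over S" "fps_nth W 0 = 0" "fps_nth W 1 \<noteq> 0"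
      using w by (simp_all add: W_def fps_over_mult fps_over_X)
    have "fps_const c * W ^ m = fps_const c * (fps_X ^ m * (fps_const (1 / c) * fps_shift m T))"
      by (simp add: W_def power_mult_distrib w v_def)
    also have "\<dots> = (fps_const c * fps_const (1 / c)) * (fps_shift m T * fps_X ^ m)"
      by (simp only: mult_ac)
    also have "\<dots> = fps_shift m T * fps_X ^ m"
      using c by simp
    also have "\<dots> = T"
      by (simp add: m_def flip: subdegree_decompose)
    finally have T: "fps_const c * W ^ m = T" .
    have "map_vec (\<lambda>f. fps_compose f W) (map_vec (\<lambda>f. fps_compose f (fps_X ^ m)) (line_param n b a c))
        = map_vec (\<lambda>f. fps_compose f (W ^ m)) (line_param n b a c)"
      using W m by (intro eq_vecI) (simp_all add: fps_compose_assoc[symmetric] fps_compose_power[symmetric])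
    also have "\<dots> = vCons T (vec n (\<lambda>i. fps_const (b $ i) * T + fps_const (a $ i)))"
      using W m by (subst comp) (simp_all add: T)
    finally have "param_equiv S (map_vec (\<lambda>f. fps_compose f (fps_X ^ m)) (line_param n b a c)) f"
      unfolding param_equiv_def using W hS h0 f_eq by metis
    then have "reducible_param S n (projective_closure n U) f"
      unfolding reducible_param_def using line_param_local[OF c] m2 by blast
    with f(2) show False by blast
  qed
  then have "fps_nth T 1 \<noteq> 0"
    using T_nz nth_subdegree_nonzero[of T] by (simp add: m_def)
  moreover have "f = h \<cdot>\<^sub>v map_vec (\<lambda>f. fps_compose f T) (line_param n b a 1)"
    using f_eq comp[OF T0, of 1] by simp
  ultimately show ?thesis
    unfolding param_equiv_def using TS T0 hS h0 by blast
qed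

lemma line_ex1_branch: "\<exists>!B. B \<in> branches_at_infinity S n U"
  unfolding ex1_branch_iff
proof (intro conjI allI impI)
  show "\<exists>f. local_param S n (projective_closure n U) f \<and>
      \<not> reducible_param S n (projective_closure n U) f \<and> fps_nth (f $ 0) 0 = 0"
    using line_param_local[OF one_mem] line_param_irreducible[OF one_mem]
    by (intro exI[of _ "line_param n b a 1"]) (auto simp: line_param_def)
  fix f g
  assume "local_param S n (projective_closure n U) f \<and>
      \<not> reducible_param S n (projective_closure n U) f \<and> fps_nth (f $ 0) 0 = 0"
    and "local_param S n (projective_closure n U) g \<and>
      \<not> reducible_param S n (projective_closure n U) g \<and> fps_nth (g $ 0) 0 = 0"
  then show "param_equiv S f g"
    using line_param_unique param_equiv_sym param_equiv_trans by blast
qed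

lemma line_polynomially_parametrizable: "polynomially_parametrizable S n U"
  unfolding polynomially_parametrizable_def
proof (intro bexI conjI allI impI)
  let ?p = "vec n (\<lambda>i. [:b $ i, a $ i:])"
  show "?p \<in> carrier_vec n" by simp
  show "?p $ i \<in> polys_over S" if "i < n" for i
    using that S by (simp add: pCons_polys zero_polys)
  have "ratfun_image n (map_vec (\<lambda>q. Fract q 1) ?p) = U"
  proof (intro equalityI subsetI)
    fix x assume "x \<in> ratfun_image n (map_vec (\<lambda>q. Fract q 1) ?p)"
    then obtain t where x: "x \<in> carrier_vec n" and t: "\<And>i. i < n \<Longrightarrow> ratfun_value (Fract [:b $ i, a $ i:] 1) t (x $ i)"
      by (auto simp: ratfun_image_def)
    have "x = b + t \<cdot>\<^sub>v a"
      using x ab ratfun_value_Fract[OF t] by (intro eq_vecI) (auto simp: algebra_simps)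
    then show "x \<in> U" by blast
  next
    fix x assume "x \<in> U"
    then obtain t where t: "x = b + t \<cdot>\<^sub>v a" by blast
    have "ratfun_value (Fract [:b $ i, a $ i:] 1) t (b $ i + t * a $ i)" for i
      using ratfun_value_intro[of 1 t "[:b $ i, a $ i:]"] by simp
    then show "x \<in> ratfun_image n (map_vec (\<lambda>q. Fract q 1) ?p)"
      using t ab by (auto simp: ratfun_image_def)
  qed
  moreover have "{s. b + s \<cdot>\<^sub>v a \<in> U} = UNIV" by blast
  ultimately show "zariski_closure n (ratfun_image n (map_vec (\<lambda>q. Fract q 1) ?p)) = U"
    using zariski_closure_line[OF ab subset_refl] infinite_UNIV_char_0[where 'a = 'a] by simp
qed

end

end

section \<open>Hypercircles with a pole outside the base field\<close>

definition homog_coord :: "nat \<Rightarrow> 'a::field \<Rightarrow> 'a fps vec \<Rightarrow> 'a fps" where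
  "homog_coord n \<gamma> A = (\<Sum>i<n. fps_const (\<gamma> ^ i) * A $ Suc i)"

lemma homog_coord_compose:
  assumes "A \<in> carrier_vec (Suc n)" "fps_nth G 0 = 0"
  shows "homog_coord n \<gamma> (\<rho> \<cdot>\<^sub>v map_vec (\<lambda>f. fps_compose f G) A) = \<rho> * fps_compose (homog_coord n \<gamma> A) G"
  using assms
  by (simp add: homog_coord_def fps_compose_sum_distrib fps_compose_mult_distrib sum_distrib_left mult.left_commute)

lemma subdegree_linear_unit:
  fixes g a :: "'a::field"
  assumes "g \<noteq> 0"
  shows "subdegree (fps_const g + fps_const a * fps_X) = 0" "fps_const g + fps_const a * fps_X \<noteq> 0"
proof -
  have "fps_nth (fps_const g + fps_const a * fps_X) 0 = g" by simp
  with assms show "subdegree (fps_const g + fps_const a * fps_X) = 0" "fps_const g + fps_const a * fps_X \<noteq> 0"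
    by auto
qed

lemma infinite_nonroots:
  assumes "p \<noteq> 0"
  shows "infinite {t :: 'a::field_char_0. poly p t \<noteq> 0}"
proof -
  have "{t. poly p t \<noteq> 0} = UNIV - {t. poly p t = 0}" by auto
  then show ?thesis
    using poly_roots_finite[OF assms] infinite_UNIV_char_0[where 'a = 'a] by simp
qed

context power_basis
begin

lemma conjugate_map_self: "x \<in> L \<Longrightarrow> conjugate_map \<alpha> x = x"
  using ex_poly[of x] conjugate_map_poly[OF minpoly(4)] by auto

lemma conjugate_map_uminus:
  assumes "poly minpoly \<beta> = 0" "x \<in> L"
  shows "conjugate_map \<beta> (- x) = - conjugate_map \<beta> x"
  using conjugate_map_add[OF assms(1) assms(2) L.uminus_mem[OF assms(2)]]
    conjugate_map_base[OF assms(1) K.zero_mem] by (simp add: eq_neg_iff_add_eq_0 add.commute)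

lemma components_conjugate_sum:
  assumes L: "a \<in> L" "b \<in> L" "c \<in> L" "d \<in> L" and det: "a * d - b * c \<noteq> 0"
    and \<gamma>: "poly minpoly \<gamma> = 0"
  defines "\<sigma> \<equiv> conjugate_map \<gamma>"
  shows "(\<Sum>i<n. unit_components K \<alpha> n (mobius a b c d) $ i * Fract [:\<gamma> ^ i:] 1)
    = mobius (\<sigma> a) (\<sigma> b) (\<sigma> c) (\<sigma> d)"
proof -
  obtain M q where M: "M \<in> polys_over K" "M \<noteq> 0" "\<And>i. q i \<in> polys_over K"
    "unit_components K \<alpha> n (mobius a b c d) = vec n (\<lambda>i. Fract (q i) M)"
    "[:d, c:] * (\<Sum>i<n. Polynomial.smult (\<alpha> ^ i) (q i)) = [:b, a:] * M"
    by (rule unit_components[OF L det]) blast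
  have eq: "[:\<sigma> d, \<sigma> c:] * (\<Sum>i<n. Polynomial.smult (\<gamma> ^ i) (q i)) = [:\<sigma> b, \<sigma> a:] * M"
    unfolding \<sigma>_def by (rule conjugate_components[OF L \<gamma> M(1,3,5)])
  have "\<sigma> c \<noteq> 0 \<or> \<sigma> d \<noteq> 0"
    using det conjugate_map_eq_0[OF \<gamma>, of c] conjugate_map_eq_0[OF \<gamma>, of d] L by (auto simp: \<sigma>_def)
  then have nz: "[:\<sigma> d, \<sigma> c:] \<noteq> 0" by auto
  have "(\<Sum>i<n. unit_components K \<alpha> n (mobius a b c d) $ i * Fract [:\<gamma> ^ i:] 1)
      = (\<Sum>i<n. Fract (q i) M * Fract [:\<gamma> ^ i:] 1)"
    unfolding M(4) by (intro sum.cong) auto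
  also have "\<dots> = Fract (\<Sum>i<n. Polynomial.smult (\<gamma> ^ i) (q i)) M"
    using M(2) by (intro sum_Fract_common) simp_all
  also have "\<dots> = mobius (\<sigma> a) (\<sigma> b) (\<sigma> c) (\<sigma> d)"
    unfolding mobius_def eq_fract(1)[OF M(2) nz] by (metis eq mult.commute)
  finally show ?thesis .
qed

context
  fixes a b e :: 'f and U :: "'f vec set" and \<beta> :: 'f
  assumes abe: "a \<in> L" "b \<in> L" "e \<in> L" "b + a * e \<noteq> 0"
    and U_def: "U = hypercircle K \<alpha> n (mobius a b 1 (- e))"
    and \<beta>: "poly minpoly \<beta> = 0" "conjugate_map \<beta> e \<noteq> e"
begin

abbreviation "\<phi> \<equiv> unit_components K \<alpha> n (mobius a b 1 (- e))"
abbreviation "cj \<equiv> conjugate_map"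

lemma det: "a * (- e) - b * 1 \<noteq> 0"
proof -
  have "a * (- e) - b * 1 = - (b + a * e)" by simp
  with abe(4) show ?thesis by (simp only: neg_equal_0_iff_equal not_False_eq_True)
qed

lemma cj_pole: "poly minpoly \<gamma> = 0 \<Longrightarrow> cj \<gamma> b + cj \<gamma> a * cj \<gamma> e \<noteq> 0"
proof
  assume \<gamma>: "poly minpoly \<gamma> = 0" and "cj \<gamma> b + cj \<gamma> a * cj \<gamma> e = 0"
  then have "cj \<gamma> (b + a * e) = 0"
    using abe by (simp add: conjugate_map_add conjugate_map_mult L.mult_mem)
  then show False
    using conjugate_map_eq_0[OF \<gamma>] abe by (simp add: L.mem)
qed

lemma phi_conjugate_sum:
  assumes \<gamma>: "poly minpoly \<gamma> = 0"
  shows "(\<Sum>i<n. \<phi> $ i * Fract [:\<gamma> ^ i:] 1) = Fract [:cj \<gamma> b, cj \<gamma> a:] [:- cj \<gamma> e, 1:]"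
  using components_conjugate_sum[OF abe(1,2) L.one_mem L.uminus_mem[OF abe(3)] det \<gamma>]
    conjugate_map_base[OF \<gamma> K.one_mem] conjugate_map_uminus[OF \<gamma> abe(3)]
  by (simp only: mobius_def)

lemma phi_common:
  obtains M q where "M \<noteq> 0" "\<And>i. i < n \<Longrightarrow> \<phi> $ i = Fract (q i) M"
proof -
  obtain M q where "M \<in> polys_over K" "M \<noteq> 0" "\<And>i. q i \<in> polys_over K" "\<phi> = vec n (\<lambda>i. Fract (q i) M)"
    "[:- e, 1:] * (\<Sum>i<n. Polynomial.smult (\<alpha> ^ i) (q i)) = [:b, a:] * M"
    by (rule unit_components[OF abe(1,2) L.one_mem L.uminus_mem[OF abe(3)] det]) blast
  with that show thesis by simp
qed

lemma U_closure: "U = zariski_closure n (ratfun_image n \<phi>)"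
  by (simp add: U_def hypercircle_def)

lemma U_carrier: "U \<subseteq> carrier_vec n"
  unfolding U_closure by (rule zariski_closure_carrier)

lemma image_subset_U: "ratfun_image n \<phi> \<subseteq> U"
  unfolding U_closure by (rule zariski_closure_subset) (auto simp: ratfun_image_def)

lemma image_point:
  assumes "\<And>i. i < n \<Longrightarrow> \<phi> $ i = Fract (q i) M" "poly M t \<noteq> 0"
  shows "vec n (\<lambda>i. poly (q i) t / poly M t) \<in> ratfun_image n \<phi>"
  using assms by (auto simp: ratfun_image_def intro!: exI[of _ t] ratfun_value_intro)

lemma image_relation:
  assumes t: "\<And>i. i < n \<Longrightarrow> ratfun_value (\<phi> $ i) t (x $ i)" and \<gamma>: "poly minpoly \<gamma> = 0"
  shows "(t - cj \<gamma> e) * (\<Sum>i<n. \<gamma> ^ i * x $ i) = cj \<gamma> a * t + cj \<gamma> b"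
proof -
  have "ratfun_value (\<Sum>i<n. \<phi> $ i * Fract [:\<gamma> ^ i:] 1) t (\<Sum>i<n. x $ i * \<gamma> ^ i)"
    using t by (intro ratfun_value_sum ratfun_value_mult ratfun_value_const) auto
  then have "(\<Sum>i<n. x $ i * \<gamma> ^ i) * poly [:- cj \<gamma> e, 1:] t = poly [:cj \<gamma> b, cj \<gamma> a:] t"
    unfolding phi_conjugate_sum[OF \<gamma>] by (rule ratfun_value_Fract) simp
  then show ?thesis
    by (simp add: algebra_simps)
qed

text \<open>Eliminating the parameter between two conjugate coordinates puts the curve on a hyperbola.\<close>

lemma image_hyperbola:
  assumes "x \<in> ratfun_image n \<phi>"
  defines "y \<equiv> \<Sum>i<n. \<alpha> ^ i * x $ i" and "y' \<equiv> \<Sum>i<n. \<beta> ^ i * x $ i"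
  shows "(b + e * y) * (y' - cj \<beta> a) = (cj \<beta> b + cj \<beta> e * y') * (y - a)"
proof -
  obtain t where t: "\<And>i. i < n \<Longrightarrow> ratfun_value (\<phi> $ i) t (x $ i)"
    using assms(1) by (auto simp: ratfun_image_def)
  have r1: "t * (y - a) = b + e * y"
    using image_relation[OF t minpoly(4)] by (simp add: conjugate_map_self abe y_def algebra_simps)
  have r2: "t * (y' - cj \<beta> a) = cj \<beta> b + cj \<beta> e * y'"
    using image_relation[OF t \<beta>(1)] by (simp add: y'_def algebra_simps)
  show ?thesis
    unfolding r1[symmetric] r2[symmetric] by (simp only: mult_ac)
qed

lemma U_hyperbola:
  assumes "x \<in> U"
  defines "y \<equiv> \<Sum>i<n. \<alpha> ^ i * x $ i" and "y' \<equiv> \<Sum>i<n. \<beta> ^ i * x $ i"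
  shows "(b + e * y) * (y' - cj \<beta> a) = (cj \<beta> b + cj \<beta> e * y') * (y - a)"
proof -
  let ?X = "\<lambda>i. Poly_Mapping.single (Poly_Mapping.single i 1) 1 :: 'f mpoly"
  let ?c = "\<lambda>c. Poly_Mapping.single 0 c :: 'f mpoly"
  let ?Y = "\<lambda>\<gamma>. \<Sum>i<n. ?c (\<gamma> ^ i) * ?X i"
  let ?P = "(?c b + ?c e * ?Y \<alpha>) * (?Y \<beta> - ?c (cj \<beta> a)) - (?c (cj \<beta> b) + ?c (cj \<beta> e) * ?Y \<beta>) * (?Y \<alpha> - ?c a)"
  have "mpoly_eval id x ?P = 0"
  proof (rule zariski_closureD)
    show "x \<in> zariski_closure n (ratfun_image n \<phi>)"
      using assms(1) by (simp only: U_closure)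
    show "?P \<in> mpolys n"
      by (intro mpolys_diff mpolys_add mpolys_mult mpolys_sum mpolys_const mpolys_var) auto
    show "mpoly_eval id z ?P = 0" if "z \<in> ratfun_image n \<phi>" for z
      using image_hyperbola[OF that] by simp
  qed
  then show ?thesis
    by (simp add: y_def y'_def)
qed

lemma local_param_hyperbola:
  assumes f: "local_param S n (projective_closure n U) f"
  defines "y \<equiv> homog_coord n \<alpha> f" and "y' \<equiv> homog_coord n \<beta> f"
  shows "(fps_const b * f $ 0 + fps_const e * y) * (y' - fps_const (cj \<beta> a) * f $ 0)
      = (fps_const (cj \<beta> b) * f $ 0 + fps_const (cj \<beta> e) * y') * (y - fps_const a * f $ 0)"
proof -
  let ?X = "\<lambda>i. Poly_Mapping.single (Poly_Mapping.single i 1) 1 :: 'f mpoly"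
  let ?c = "\<lambda>c. Poly_Mapping.single 0 c :: 'f mpoly"
  let ?Y = "\<lambda>\<gamma>. \<Sum>i<n. ?c (\<gamma> ^ i) * ?X (Suc i)"
  let ?P = "(?c b * ?X 0 + ?c e * ?Y \<alpha>) * (?Y \<beta> - ?c (cj \<beta> a) * ?X 0)
    - (?c (cj \<beta> b) * ?X 0 + ?c (cj \<beta> e) * ?Y \<beta>) * (?Y \<alpha> - ?c a * ?X 0)"
  have "mpoly_eval fps_const f ?P = 0"
  proof (rule local_paramD[OF f U_carrier])
    show "?P \<in> forms (Suc n) (1 + 1)"
      by (intro forms_diff forms_mult forms_add forms_scale forms_sum forms_var) auto
    show "mpoly_eval id (vCons 1 x) ?P = 0" if "x \<in> U" for x
      using U_hyperbola[OF that] by simp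
  qed
  then show ?thesis
    by (simp add: y_def y'_def homog_coord_def)
qed

lemma no_branch_over_K:
  assumes f: "local_param K n (projective_closure n U) f"
  shows "fps_nth (f $ 0) 0 \<noteq> 0"
proof
  assume f0: "fps_nth (f $ 0) 0 = 0"
  define z where "z \<gamma> = (\<Sum>i<n. fps_nth (f $ Suc i) 0 * \<gamma> ^ i)" for \<gamma>
  have z: "fps_nth (homog_coord n \<gamma> f) 0 = z \<gamma>" for \<gamma>
    by (simp add: homog_coord_def z_def fps_sum_nth mult.commute)
  have "e * z \<alpha> * z \<beta> = cj \<beta> e * z \<beta> * z \<alpha>"
    using arg_cong[OF local_param_hyperbola[OF f], of "\<lambda>h. fps_nth h 0"] f0 by (simp add: z)
  then have "(e - cj \<beta> e) * (z \<alpha> * z \<beta>) = 0"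
    by (simp add: algebra_simps)
  then obtain \<gamma> where \<gamma>: "poly minpoly \<gamma> = 0" "z \<gamma> = 0"
    using \<beta> minpoly(4) by auto
  have "fps_nth (f $ Suc i) 0 = 0" if "i < n" for i
  proof (rule indep_sum[OF \<gamma>(1) _ \<gamma>(2)[unfolded z_def] that])
    show "fps_nth (f $ Suc i) 0 \<in> K" if "i < n" for i
      using f that by (auto simp: local_param_def fps_over_def)
  qed
  then have "fps_nth (f $ i) 0 = 0" if "i \<le> n" for i
    using that f0 by (cases i) auto
  then show False
    using f by (auto simp: local_param_def)
qed

lemma not_polynomially_parametrizable: "\<not> polynomially_parametrizable S n U"
proof
  assume "polynomially_parametrizable S n U"
  then obtain p where p: "p \<in> carrier_vec n"
    and cl: "zariski_closure n (ratfun_image n (map_vec (\<lambda>q. Fract q 1) p)) = U"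
    unfolding polynomially_parametrizable_def by blast
  let ?I = "ratfun_image n (map_vec (\<lambda>q. Fract q 1) p)"
  define y where "y \<gamma> = (\<Sum>i<n. Polynomial.smult (\<gamma> ^ i) (p $ i))" for \<gamma>
  define w where "w = y \<alpha> - [:a:]"
  define w' where "w' = y \<beta> - [:cj \<beta> a:]"
  define g where "g = b + a * e"
  define g' where "g' = cj \<beta> b + cj \<beta> a * cj \<beta> e"
  define \<delta> where "\<delta> = e - cj \<beta> e"
  have nz: "g \<noteq> 0" "g' \<noteq> 0" "\<delta> \<noteq> 0"
    using abe(4) cj_pole[OF \<beta>(1)] \<beta>(2) by (simp_all add: g_def g'_def \<delta>_def)
  have "poly (([:g:] + Polynomial.smult \<delta> w) * (Polynomial.smult \<delta> w' - [:g':])) s = poly [:- (g * g'):] s" for s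
  proof -
    let ?x = "vec n (\<lambda>i. poly (p $ i) s)"
    have "?x \<in> ?I"
      using p ratfun_value_intro[of 1 s] by (fastforce simp: ratfun_image_def)
    moreover have "?I \<subseteq> carrier_vec n"
      by (auto simp: ratfun_image_def)
    ultimately have "?x \<in> U"
      using zariski_closure_subset[of ?I n] cl by blast
    from U_hyperbola[OF this]
    have "(g + e * poly w s) * poly w' s = (g' + cj \<beta> e * poly w' s) * poly w s"
      by (simp add: w_def w'_def y_def g_def g'_def poly_sum algebra_simps)
    then have "\<delta> * (g * poly w' s - g' * poly w s + \<delta> * (poly w s * poly w' s)) = 0"
      by (simp add: \<delta>_def algebra_simps)
    then show ?thesis
      by (simp add: algebra_simps)
  qed
  then have prod: "([:g:] + Polynomial.smult \<delta> w) * (Polynomial.smult \<delta> w' - [:g':]) = [:- (g * g'):]"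
    using poly_eq_poly_eq_iff by blast
  then have "[:g:] + Polynomial.smult \<delta> w dvd [:- (g * g'):]"
    by (metis dvd_triv_left)
  then have "Polynomial.degree ([:g:] + Polynomial.smult \<delta> w) = 0"
    using nz dvd_imp_degree_le[of _ "[:- (g * g'):]"] by fastforce
  then obtain k where "[:g:] + Polynomial.smult \<delta> w = [:k:]"
    using degree_eq_zeroE by blast
  then have "poly ([:g:] + Polynomial.smult \<delta> w) s = k" for s
    by simp
  then have w: "poly w s = (k - g) / \<delta>" for s
    using nz(3) by (simp add: field_simps)
  define c where "c = (k - g) / \<delta> + a"
  let ?X = "\<lambda>i. Poly_Mapping.single (Poly_Mapping.single i 1) 1 :: 'f mpoly"
  let ?c = "\<lambda>c. Poly_Mapping.single 0 c :: 'f mpoly"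
  let ?P = "(\<Sum>i<n. ?c (\<alpha> ^ i) * ?X i) - ?c c"
  have const: "(\<Sum>i<n. \<alpha> ^ i * x $ i) = c" if "x \<in> U" for x
  proof -
    have "mpoly_eval id x ?P = 0"
    proof (rule zariski_closureD)
      show "x \<in> zariski_closure n ?I"
        using that cl by simp
      show "?P \<in> mpolys n"
        by (intro mpolys_diff mpolys_mult mpolys_sum mpolys_const mpolys_var) auto
      fix z assume "z \<in> ?I"
      then obtain s where s: "\<And>i. i < n \<Longrightarrow> ratfun_value (Fract (p $ i) 1) s (z $ i)"
        using p by (auto simp: ratfun_image_def)
      have "(\<Sum>i<n. \<alpha> ^ i * z $ i) = poly (y \<alpha>) s"
        using ratfun_value_Fract[OF s] by (simp add: y_def poly_sum)
      also have "\<dots> = c"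
        using w[of s] by (simp add: w_def c_def algebra_simps)
      finally show "mpoly_eval id z ?P = 0" by simp
    qed
    then show ?thesis by simp
  qed
  obtain M q where M: "M \<noteq> 0" "\<And>i. i < n \<Longrightarrow> \<phi> $ i = Fract (q i) M"
    by (rule phi_common) blast
  have "poly [:- e * c - b, c - a:] t = 0" if t: "poly M t \<noteq> 0" for t
  proof -
    let ?x = "vec n (\<lambda>i. poly (q i) t / poly M t)"
    have "?x \<in> U"
      using image_point[OF M(2) t] image_subset_U by blast
    moreover have "ratfun_value (\<phi> $ i) t (?x $ i)" if "i < n" for i
      using that M(2)[OF that] ratfun_value_intro[OF t] by simp
    ultimately have "(t - e) * c = a * t + b"
      using image_relation[OF _ minpoly(4), of t ?x] const[of ?x] by (simp add: conjugate_map_self abe)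
    then show ?thesis
      by (simp add: algebra_simps)
  qed
  then have "{t. poly M t \<noteq> 0} \<subseteq> {t. poly [:- e * c - b, c - a:] t = 0}"
    by blast
  then have "infinite {t. poly [:- e * c - b, c - a:] t = 0}"
    using infinite_nonroots[OF M(1)] infinite_super by blast
  then have "[:- e * c - b, c - a:] = 0"
    using poly_roots_finite by blast
  then have "c = a" "b = - e * c"
    by (auto simp: algebra_simps)
  then show False
    using nz(1) by (simp add: g_def)
qed

text \<open>A reparametrization of higher order multiplies the orders of all coordinates by a common
  factor at least 2; the expansion at a simple pole is irreducible because two orders differ by 1.\<close>

lemma ex_pole_expansion:
  assumes \<gamma>: "poly minpoly \<gamma> = 0"
  obtains A where "local_param UNIV n (projective_closure n U) A"
    "\<not> reducible_param UNIV n (projective_closure n U) A" "fps_nth (A $ 0) 0 = 0"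
    "A $ 0 \<noteq> 0" "homog_coord n \<gamma> A \<noteq> 0" "subdegree (A $ 0) = Suc (subdegree (homog_coord n \<gamma> A))"
    "\<And>\<theta>. poly minpoly \<theta> = 0 \<Longrightarrow> (fps_const (cj \<gamma> e - cj \<theta> e) + fps_const 1 * fps_X) * homog_coord n \<theta> A
      = (fps_const (cj \<theta> b + cj \<theta> a * cj \<gamma> e) + fps_const (cj \<theta> a) * fps_X) * A $ 0"
proof -
  define t0 where "t0 = cj \<gamma> e"
  define P where "P M \<longleftrightarrow> M \<noteq> 0 \<and> (\<exists>q. \<forall>i<n. \<phi> $ i = Fract (q i) M)" for M
  obtain M0 q0 where "M0 \<noteq> 0" "\<And>i. i < n \<Longrightarrow> \<phi> $ i = Fract (q0 i) M0"
    by (rule phi_common) blast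
  then have "P M0" by (auto simp: P_def)
  define D where "D = arg_min Polynomial.degree P"
  have D: "P D" and least: "\<And>M. P M \<Longrightarrow> Polynomial.degree D \<le> Polynomial.degree M"
    using arg_min_nat_lemma[of P M0 Polynomial.degree] \<open>P M0\<close> by (simp_all add: D_def)
  then obtain p where p: "D \<noteq> 0" "\<And>i. i < n \<Longrightarrow> \<phi> $ i = Fract (p i) D"
    unfolding P_def by blast
  have coprime: "poly D t0 \<noteq> 0 \<or> (\<exists>i<n. poly (p i) t0 \<noteq> 0)"
  proof (rule ccontr)
    assume "\<not> (poly D t0 \<noteq> 0 \<or> (\<exists>i<n. poly (p i) t0 \<noteq> 0))"
    then have "[:- t0, 1:] dvd D" and "\<And>i. i < n \<Longrightarrow> [:- t0, 1:] dvd p i"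
      by (auto simp: poly_eq_0_iff_dvd)
    then obtain D' p' where D': "D = [:- t0, 1:] * D'" and p': "\<And>i. i < n \<Longrightarrow> p i = [:- t0, 1:] * p' i"
      unfolding dvd_def by metis
    have "D' \<noteq> 0" using D' p(1) by auto
    moreover have "\<phi> $ i = Fract (p' i) D'" if "i < n" for i
      unfolding p(2)[OF that] using that p(1) \<open>D' \<noteq> 0\<close>
      by (subst eq_fract) (simp_all only: D' p' mult_ac not_False_eq_True)
    ultimately have "Polynomial.degree D \<le> Polynomial.degree D'"
      by (intro least) (auto simp: P_def)
    then show False
      using D' \<open>D' \<noteq> 0\<close> degree_mult_eq[of "[:- t0, 1:]" D'] by simp
  qed
  define ex where "ex q = fps_of_poly (pcompose q [:t0, 1:])" for q :: "'f poly"
  have ex0: "fps_nth (ex q) 0 = poly q t0" for q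
    by (simp add: ex_def poly_pcompose flip: poly_0_coeff_0)
  have ex_nz: "ex q \<noteq> 0" if "q \<noteq> 0" for q
    using that pcompose_eq_0[of q "[:t0, 1:]"] fps_of_poly_eq_iff[of "pcompose q [:t0, 1:]" 0] by (auto simp: ex_def)
  have ex_mult: "ex (q * r) = ex q * ex r" for q r
    by (simp add: ex_def pcompose_mult fps_of_poly_mult)
  have ex_smult: "ex (Polynomial.smult k q) = fps_const k * ex q" for k q
    by (simp add: ex_def pcompose_smult fps_of_poly_smult)
  have ex_sum: "ex (\<Sum>i<n. f i) = (\<Sum>i<n. ex (f i))" for f
    by (simp add: ex_def pcompose_sum fps_of_poly_sum)
  have ex_linear: "ex [:c, d:] = fps_const (c + d * t0) + fps_const d * fps_X" for c d
    by (simp add: ex_def pcompose_pCons fps_of_poly_pCons fps_of_poly_const algebra_simps)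
  define A where "A = map_vec ex (vCons D (vec n p))"
  have A: "A \<in> carrier_vec (Suc n)" "A $ 0 = ex D" "\<And>i. i < n \<Longrightarrow> A $ Suc i = ex (p i)"
    by (simp_all add: A_def vCons_carrier)
  have coord: "homog_coord n \<theta> A = ex (\<Sum>i<n. Polynomial.smult (\<theta> ^ i) (p i))" for \<theta>
    by (simp add: homog_coord_def A ex_sum ex_smult)
  have rel: "(fps_const (t0 - cj \<theta> e) + fps_const 1 * fps_X) * homog_coord n \<theta> A
      = (fps_const (cj \<theta> b + cj \<theta> a * t0) + fps_const (cj \<theta> a) * fps_X) * A $ 0"
    if \<theta>: "poly minpoly \<theta> = 0" for \<theta>
  proof -
    have "Fract (\<Sum>i<n. Polynomial.smult (\<theta> ^ i) (p i)) D = (\<Sum>i<n. Fract (p i) D * Fract [:\<theta> ^ i:] 1)"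
      using p(1) by (intro sum_Fract_common[symmetric]) simp_all
    also have "\<dots> = (\<Sum>i<n. \<phi> $ i * Fract [:\<theta> ^ i:] 1)"
      by (intro sum.cong) (simp_all only: p(2) lessThan_iff)
    also have "\<dots> = Fract [:cj \<theta> b, cj \<theta> a:] [:- cj \<theta> e, 1:]"
      by (rule phi_conjugate_sum[OF \<theta>])
    finally have "(\<Sum>i<n. Polynomial.smult (\<theta> ^ i) (p i)) * [:- cj \<theta> e, 1:] = [:cj \<theta> b, cj \<theta> a:] * D"
      by (subst (asm) eq_fract(1)) (use p(1) in simp_all)
    from arg_cong[OF this, of ex] show ?thesis
      by (simp add: ex_mult coord A ex_linear mult.commute add.commute del: mult_pCons_left mult_pCons_right)
  qed
  have A0: "A $ 0 \<noteq> 0"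
    using ex_nz[OF p(1)] A by simp
  have pole: "cj \<gamma> b + cj \<gamma> a * t0 \<noteq> 0"
    using cj_pole[OF \<gamma>] by (simp add: t0_def)
  note unit = subdegree_linear_unit[OF pole, of "cj \<gamma> a"]
  have rel': "fps_X * homog_coord n \<gamma> A = (fps_const (cj \<gamma> b + cj \<gamma> a * t0) + fps_const (cj \<gamma> a) * fps_X) * A $ 0"
    using rel[OF \<gamma>] by (simp add: t0_def)
  then have C0: "homog_coord n \<gamma> A \<noteq> 0"
    using unit(2) A0 by (metis mult_zero_right no_zero_divisors)
  have sd: "subdegree (A $ 0) = Suc (subdegree (homog_coord n \<gamma> A))"
    using arg_cong[OF rel', of subdegree] unit A0 C0 by simp
  have local: "local_param UNIV n (projective_closure n U) A"
    unfolding local_param_def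
  proof (intro conjI ballI allI impI)
    show "A \<in> carrier_vec (Suc n)" by (fact A)
    show "A $ i \<in> fps_over UNIV" for i by (simp add: fps_over_def)
    show "\<exists>i\<le>n. fps_nth (A $ i) 0 \<noteq> 0"
      using coprime A by (metis Suc_leI ex0 le0)
    show "mpoly_eval fps_const A Q = 0"
      if Q: "Q \<in> mpolys (Suc n)" "homogeneous Q" "\<forall>x\<in>projective_closure n U. mpoly_eval id x Q = 0" for Q
      unfolding A_def ex_def
    proof (rule expansion_vanishes[OF U_carrier _ _ Q])
      show "vCons D (vec n p) \<in> carrier_vec (Suc n)" by (simp add: vCons_carrier)
      have "{t. poly D t \<noteq> 0} \<subseteq> {t. poly (vCons D (vec n p) $ 0) t \<noteq> 0 \<and>
          vec n (\<lambda>i. poly (vCons D (vec n p) $ Suc i) t / poly (vCons D (vec n p) $ 0) t) \<in> U}"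
      proof clarify
        fix t assume t: "poly D t \<noteq> 0"
        have "vec n (\<lambda>i. poly (p i) t / poly D t) \<in> U"
          using image_point[OF p(2) t] image_subset_U by blast
        moreover have "vec n (\<lambda>i. poly (vCons D (vec n p) $ Suc i) t / poly (vCons D (vec n p) $ 0) t)
            = vec n (\<lambda>i. poly (p i) t / poly D t)"
          by (intro eq_vecI) auto
        ultimately show "poly (vCons D (vec n p) $ 0) t \<noteq> 0 \<and>
          vec n (\<lambda>i. poly (vCons D (vec n p) $ Suc i) t / poly (vCons D (vec n p) $ 0) t) \<in> U"
          using t by simp
      qed
      then show "infinite {t. poly (vCons D (vec n p) $ 0) t \<noteq> 0 \<and>
          vec n (\<lambda>i. poly (vCons D (vec n p) $ Suc i) t / poly (vCons D (vec n p) $ 0) t) \<in> U}"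
        by (rule infinite_super) (rule infinite_nonroots[OF p(1)])
    qed
    show "\<not> (\<exists>\<rho>. \<exists>c\<in>carrier_vec (Suc n). A = \<rho> \<cdot>\<^sub>v map_vec fps_const c)"
    proof clarify
      fix \<rho> c assume c: "c \<in> carrier_vec (Suc n)" "A = \<rho> \<cdot>\<^sub>v map_vec fps_const c"
      have 1: "A $ 0 = \<rho> * fps_const (c $ 0)"
        using c by simp
      have "homog_coord n \<gamma> A = (\<Sum>i<n. \<rho> * fps_const (\<gamma> ^ i * c $ Suc i))"
        unfolding homog_coord_def using c
        by (intro sum.cong) (simp_all add: mult.left_commute flip: fps_const_mult)
      also have "\<dots> = \<rho> * fps_const (\<Sum>i<n. \<gamma> ^ i * c $ Suc i)"
        by (simp add: sum_distrib_left fps_const_hom.hom_sum)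
      finally have 2: "homog_coord n \<gamma> A = \<rho> * fps_const (\<Sum>i<n. \<gamma> ^ i * c $ Suc i)" .
      have "subdegree (A $ 0) = subdegree \<rho>" "subdegree (homog_coord n \<gamma> A) = subdegree \<rho>"
        using 1 2 A0 C0 by simp_all
      then show False
        using sd by simp
    qed
  qed
  have irred: "\<not> reducible_param UNIV n (projective_closure n U) A"
  proof
    assume "reducible_param UNIV n (projective_closure n U) A"
    then obtain f \<rho> G where *: "local_param UNIV n (projective_closure n U) f" "fps_nth \<rho> 0 \<noteq> 0"
      "fps_nth G 0 = 0" "subdegree G \<ge> 2" "A = \<rho> \<cdot>\<^sub>v map_vec (\<lambda>f. fps_compose f G) f"
      by (rule reducible_paramE)
    have f: "f \<in> carrier_vec (Suc n)"
      using *(1) by (simp add: local_param_def)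
    then have 1: "A $ 0 = \<rho> * fps_compose (f $ 0) G"
      using *(5) by simp
    have 2: "homog_coord n \<gamma> A = \<rho> * fps_compose (homog_coord n \<gamma> f) G"
      unfolding *(5) by (rule homog_coord_compose[OF f *(3)])
    have "subdegree (A $ 0) = subdegree (f $ 0) * subdegree G"
      using 1 A0 *(2,3) by simp
    moreover have "subdegree (homog_coord n \<gamma> A) = subdegree (homog_coord n \<gamma> f) * subdegree G"
      using 2 C0 *(2,3) by simp
    ultimately have "subdegree G dvd Suc (subdegree (homog_coord n \<gamma> A))" "subdegree G dvd subdegree (homog_coord n \<gamma> A)"
      using sd by (metis dvd_triv_right)+
    then have "subdegree G dvd 1"
      by (metis Suc_eq_plus1 dvd_add_right_iff)
    then show False
      using *(4) by simp
  qed
  show thesis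
  proof (rule that[OF local irred _ A0 C0 sd])
    show "fps_nth (A $ 0) 0 = 0"
      using sd by (intro nth_less_subdegree_zero) simp
  qed (use rel in \<open>simp add: t0_def\<close>)
qed

lemma not_ex1_branch: "\<not> (\<exists>!B. B \<in> branches_at_infinity UNIV n U)"
proof
  assume unique: "\<exists>!B. B \<in> branches_at_infinity UNIV n U"
  obtain A where A: "local_param UNIV n (projective_closure n U) A"
    "\<not> reducible_param UNIV n (projective_closure n U) A" "fps_nth (A $ 0) 0 = 0"
    "A $ 0 \<noteq> 0" "homog_coord n \<alpha> A \<noteq> 0" "subdegree (A $ 0) = Suc (subdegree (homog_coord n \<alpha> A))"
    by (rule ex_pole_expansion[OF minpoly(4)]) blast
  obtain B where B: "local_param UNIV n (projective_closure n U) B"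
    "\<not> reducible_param UNIV n (projective_closure n U) B" "fps_nth (B $ 0) 0 = 0" "B $ 0 \<noteq> 0"
    "\<And>\<theta>. poly minpoly \<theta> = 0 \<Longrightarrow> (fps_const (cj \<beta> e - cj \<theta> e) + fps_const 1 * fps_X) * homog_coord n \<theta> B
      = (fps_const (cj \<theta> b + cj \<theta> a * cj \<beta> e) + fps_const (cj \<theta> a) * fps_X) * B $ 0"
    by (rule ex_pole_expansion[OF \<beta>(1)]) blast
  have "param_equiv UNIV A B"
    using unique A(1-3) B(1-3) unfolding UNIV_subfield.ex1_branch_iff by blast
  then obtain T \<rho> where T: "fps_nth T 0 = 0" "fps_nth T 1 \<noteq> 0" "fps_nth \<rho> 0 \<noteq> 0"
    "B = \<rho> \<cdot>\<^sub>v map_vec (\<lambda>f. fps_compose f T) A"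
    unfolding param_equiv_def by blast
  have Ac: "A \<in> carrier_vec (Suc n)"
    using A(1) by (simp add: local_param_def)
  have sdT: "subdegree T = 1"
    using T by (intro subdegreeI) (auto simp: less_Suc_eq)
  have "B $ 0 = \<rho> * fps_compose (A $ 0) T"
    using T(4) Ac by simp
  then have sd0: "subdegree (B $ 0) = subdegree (A $ 0)"
    using B(4) T sdT by simp
  have coord: "homog_coord n \<alpha> B = \<rho> * fps_compose (homog_coord n \<alpha> A) T"
    unfolding T(4) by (rule homog_coord_compose[OF Ac T(1)])
  have "fps_compose (homog_coord n \<alpha> A) T \<noteq> 0"
    using A(5) T(1) sdT by (auto simp: fps_compose_eq_0_iff)
  moreover have "\<rho> \<noteq> 0" "subdegree \<rho> = 0"
    using T(3) by auto
  ultimately have nz: "homog_coord n \<alpha> B \<noteq> 0" and sd1: "subdegree (homog_coord n \<alpha> B) = subdegree (homog_coord n \<alpha> A)"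
    unfolding coord using T(1) sdT by simp_all
  have "cj \<beta> e - cj \<alpha> e \<noteq> 0"
    using \<beta>(2) by (simp add: conjugate_map_self abe)
  note unit = subdegree_linear_unit[OF this, of 1]
  let ?r = "fps_const (cj \<alpha> b + cj \<alpha> a * cj \<beta> e) + fps_const (cj \<alpha> a) * fps_X"
  have rel: "(fps_const (cj \<beta> e - cj \<alpha> e) + fps_const 1 * fps_X) * homog_coord n \<alpha> B = ?r * B $ 0"
    by (rule B(5)[OF minpoly(4)])
  then have "?r \<noteq> 0"
    using unit(2) nz by (metis mult_zero_left no_zero_divisors)
  then have "subdegree (homog_coord n \<alpha> B) = subdegree ?r + subdegree (B $ 0)"
    using arg_cong[OF rel, of subdegree] unit nz B(4) by (simp del: fps_const_1_eq_1)
  then show False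
    using sd0 sd1 A(6) by simp
qed

end

end

section \<open>Hypercircles that are lines\<close>

context power_basis
begin

lemma unit_hypercircle_line:
  assumes K: "\<And>i. i < n \<Longrightarrow> v i \<in> K" "\<And>i. i < n \<Longrightarrow> p i \<in> K" and v: "\<exists>i<n. v i \<noteq> 0"
    and M: "M = 1 \<and> g = (\<lambda>i. [:p i, v i:]) \<or> (\<exists>e\<in>K. M = [:- e, 1:] \<and> g = (\<lambda>i. [:v i - e * p i, p i:]))"
  shows "hypercircle K \<alpha> n (Fract (\<Sum>i<n. Polynomial.smult (\<alpha> ^ i) (g i)) M) = {vec n p + s \<cdot>\<^sub>v vec n v | s. True}"
proof -
  have MK: "M \<in> polys_over K" "M \<noteq> 0" "\<And>i. i < n \<Longrightarrow> g i \<in> polys_over K"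
    using M K by (auto simp: K.pCons_polys intro!: K.mem K.one_polys K.zero_polys)
  define A where "A = ratfun_image n (vec n (\<lambda>i. Fract (g i) M))"
  have vec: "vec n v \<in> carrier_vec n" "vec n p \<in> carrier_vec n" "vec n v \<noteq> 0\<^sub>v n"
    using v by (auto simp: vec_eq_iff)
  have value_eq: "x $ i * poly M t = poly (g i) t"
    if "\<And>i. i < n \<Longrightarrow> ratfun_value (Fract (g i) M) t (x $ i)" "i < n" for x t i
    using ratfun_value_Fract[OF that(1)[OF that(2)] MK(2)] .
  have value_intro: "vec n (\<lambda>i. poly (g i) t / poly M t) \<in> A" if "poly M t \<noteq> 0" for t
    using that by (auto simp: A_def ratfun_image_def intro!: exI[of _ t] ratfun_value_intro)
  have "zariski_closure n A = {vec n p + s \<cdot>\<^sub>v vec n v | s. True}"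
  proof (rule zariski_closure_line[OF vec])
    show "A \<subseteq> {vec n p + s \<cdot>\<^sub>v vec n v | s. True}"
    proof
      fix x assume "x \<in> A"
      then obtain t where x: "x \<in> carrier_vec n" "\<And>i. i < n \<Longrightarrow> ratfun_value (Fract (g i) M) t (x $ i)"
        by (auto simp: A_def ratfun_image_def)
      have eq: "x $ i * poly M t = poly (g i) t" if "i < n" for i
        using value_eq[OF x(2) that] .
      from M have "\<exists>s. \<forall>i<n. x $ i = p i + s * v i"
      proof (elim disjE conjE bexE)
        assume "M = 1" "g = (\<lambda>i. [:p i, v i:])"
        with eq show ?thesis by (intro exI[of _ t]) simp
      next
        fix e assume *: "M = [:- e, 1:]" "g = (\<lambda>i. [:v i - e * p i, p i:])"
        have eq': "x $ i * (t - e) = v i + p i * (t - e)" if "i < n" for i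
          using eq[OF that] by (simp add: * algebra_simps)
        have "t - e \<noteq> 0"
        proof
          assume "t - e = 0"
          with eq' v show False by auto
        qed
        with eq' show ?thesis
          by (intro exI[of _ "1 / (t - e)"]) (simp add: field_simps)
      qed
      then obtain s where "\<And>i. i < n \<Longrightarrow> x $ i = p i + s * v i" by blast
      with x(1) have "x = vec n p + s \<cdot>\<^sub>v vec n v"
        by (intro eq_vecI) auto
      then show "x \<in> {vec n p + s \<cdot>\<^sub>v vec n v | s. True}" by blast
    qed
    have "- {0} \<subseteq> {s. vec n p + s \<cdot>\<^sub>v vec n v \<in> A}"
    proof
      fix s :: 'f assume "s \<in> - {0}"
      then have s: "s \<noteq> 0" by simp
      from M have "\<exists>t. poly M t \<noteq> 0 \<and> (\<forall>i<n. poly (g i) t / poly M t = p i + s * v i)"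
      proof (elim disjE conjE bexE)
        assume "M = 1" "g = (\<lambda>i. [:p i, v i:])"
        then show ?thesis by (intro exI[of _ s]) simp
      next
        fix e assume "M = [:- e, 1:]" "g = (\<lambda>i. [:v i - e * p i, p i:])"
        with s show ?thesis by (intro exI[of _ "e + 1 / s"]) (simp add: field_simps)
      qed
      then obtain t where t: "poly M t \<noteq> 0" "\<And>i. i < n \<Longrightarrow> poly (g i) t / poly M t = p i + s * v i"
        by blast
      have "vec n (\<lambda>i. poly (g i) t / poly M t) = vec n p + s \<cdot>\<^sub>v vec n v"
        using t(2) by (intro eq_vecI) auto
      with value_intro[OF t(1)] show "s \<in> {s. vec n p + s \<cdot>\<^sub>v vec n v \<in> A}"
        by simp
    qed
    moreover have "infinite (- {0 :: 'f})"
      using infinite_UNIV_char_0 by (simp add: Compl_eq_Diff_UNIV)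
    ultimately show "infinite {s. vec n p + s \<cdot>\<^sub>v vec n v \<in> A}"
      by (rule infinite_super)
  qed
  moreover have "unit_components K \<alpha> n (Fract (\<Sum>i<n. Polynomial.smult (\<alpha> ^ i) (g i)) M)
      = vec n (\<lambda>i. Fract (g i) M)"
    by (rule unit_components_eqI[OF is_components_Fract]) (fact MK)+
  ultimately show ?thesis
    by (simp only: hypercircle_def A_def)
qed

lemma sum_smult_linear:
  "(\<Sum>i<n. Polynomial.smult (\<alpha> ^ i) [:f i, h i:]) = [:\<Sum>i<n. f i * \<alpha> ^ i, \<Sum>i<n. h i * \<alpha> ^ i:]"
  by (rule poly_eqI) (simp add: Polynomial.coeff_sum coeff_pCons mult.commute split: nat.split)

lemma hypercircle_polynomial_unit:
  assumes K: "\<And>i. i < n \<Longrightarrow> v i \<in> K" "\<And>i. i < n \<Longrightarrow> p i \<in> K" and v: "\<exists>i<n. v i \<noteq> 0"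
  shows "hypercircle K \<alpha> n (Fract [:\<Sum>i<n. p i * \<alpha> ^ i, \<Sum>i<n. v i * \<alpha> ^ i:] 1)
    = {vec n p + s \<cdot>\<^sub>v vec n v | s. True}"
proof -
  have "hypercircle K \<alpha> n (Fract (\<Sum>i<n. Polynomial.smult (\<alpha> ^ i) [:p i, v i:]) 1)
      = {vec n p + s \<cdot>\<^sub>v vec n v | s. True}"
    by (rule unit_hypercircle_line) (use assms in auto)
  then show ?thesis
    by (simp only: sum_smult_linear)
qed

lemma hypercircle_pole_in_K:
  assumes ab: "a \<in> L" "b \<in> L" and e: "e \<in> K" and g: "b + a * e \<noteq> 0"
  shows "hypercircle K \<alpha> n (mobius a b 1 (- e)) = hypercircle K \<alpha> n (Fract [:a, b + a * e:] 1)"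
proof -
  have "b + a * e \<in> L"
    using ab e K_subset by (intro L.add_mem L.mult_mem) auto
  then obtain v where v: "\<And>i. v i \<in> K" "b + a * e = (\<Sum>i<n. v i * \<alpha> ^ i)"
    by (rule rep_sum) blast
  obtain p where p: "\<And>i. p i \<in> K" "a = (\<Sum>i<n. p i * \<alpha> ^ i)"
    using ab(1) by (rule rep_sum) blast
  have ex: "\<exists>i<n. v i \<noteq> 0"
    using g unfolding v(2) by (metis (no_types, lifting) lessThan_iff mult_zero_left sum.neutral)
  have "(\<Sum>i<n. (v i - e * p i) * \<alpha> ^ i) = (b + a * e) - e * a"
    unfolding v(2) unfolding p(2) by (simp only: left_diff_distrib sum_subtractf mult.assoc sum_distrib_left)
  then have "mobius a b 1 (- e) = Fract (\<Sum>i<n. Polynomial.smult (\<alpha> ^ i) [:v i - e * p i, p i:]) [:- e, 1:]"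
    by (simp only: sum_smult_linear mobius_def flip: p(2)) (simp add: mult.commute)
  also have "hypercircle K \<alpha> n \<dots> = {vec n p + s \<cdot>\<^sub>v vec n v | s. True}"
    by (rule unit_hypercircle_line) (use v(1) p(1) ex e in auto)
  also have "\<dots> = hypercircle K \<alpha> n (Fract [:a, b + a * e:] 1)"
    unfolding v(2) unfolding p(2) by (rule hypercircle_polynomial_unit[symmetric]) (use v(1) p(1) ex in auto)
  finally show ?thesis .
qed

lemma polynomial_unit_line:
  assumes "a \<in> L" "b \<in> L" "a \<noteq> 0"
  obtains p v where "p \<in> carrier_vec n" "v \<in> carrier_vec n" "v \<noteq> 0\<^sub>v n"
    "\<And>i. i < n \<Longrightarrow> p $ i \<in> K" "\<And>i. i < n \<Longrightarrow> v $ i \<in> K"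
    "hypercircle K \<alpha> n (Fract [:b, a:] 1) = {p + s \<cdot>\<^sub>v v | s. True}"
proof -
  obtain v where v: "\<And>i. v i \<in> K" "a = (\<Sum>i<n. v i * \<alpha> ^ i)"
    using assms(1) by (rule rep_sum) blast
  obtain p where p: "\<And>i. p i \<in> K" "b = (\<Sum>i<n. p i * \<alpha> ^ i)"
    using assms(2) by (rule rep_sum) blast
  have ex: "\<exists>i<n. v i \<noteq> 0"
    using assms(3) unfolding v(2) by (metis (no_types, lifting) lessThan_iff mult_zero_left sum.neutral)
  show thesis
  proof (rule that[of "vec n p" "vec n v"])
    show "vec n v \<noteq> 0\<^sub>v n"
      using ex by (auto simp: vec_eq_iff)
    show "hypercircle K \<alpha> n (Fract [:b, a:] 1) = {vec n p + s \<cdot>\<^sub>v vec n v | s. True}"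
      using hypercircle_polynomial_unit[of v p] v p ex by simp
  qed (use v p in auto)
qed

lemma unit_pole_in_K:
  assumes L: "a \<in> L" "b \<in> L" "c \<in> L" "d \<in> L" and det: "a * d - b * c \<noteq> 0"
    and pole: "c = 0 \<or> - d / c \<in> K"
  obtains a' b' where "a' \<in> L" "b' \<in> L" "a' \<noteq> 0"
    "hypercircle K \<alpha> n (mobius a b c d) = hypercircle K \<alpha> n (Fract [:b', a':] 1)"
proof (cases "c = 0")
  case True
  then have nz: "a \<noteq> 0" "d \<noteq> 0" using det by auto
  have "Polynomial.smult d [:b / d, a / d:] = [:b, a:]"
    using nz by simp
  then have "mobius a b c d = Fract [:b / d, a / d:] 1"
    using nz True by (simp add: mobius_def eq_fract)
  with nz L show thesis
    by (intro that[of "a / d" "b / d"]) (auto intro: L.divide_mem)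
next
  case False
  let ?e = "- d / c"
  have "mobius a b c d = mobius (a / c) (b / c) 1 (- ?e)"
    using mobius_scale[OF False False, of a b d] False by simp
  moreover have nz: "b / c + a / c * ?e \<noteq> 0"
    using det False by (simp add: field_simps)
  ultimately have "hypercircle K \<alpha> n (mobius a b c d) = hypercircle K \<alpha> n (Fract [:a / c, b / c + a / c * ?e:] 1)"
    using hypercircle_pole_in_K[of "a / c" "b / c" ?e] L pole False by (simp add: L.divide_mem)
  with nz L pole False K_subset show thesis
    by (intro that[of "b / c + a / c * ?e" "a / c"]) (auto intro!: L.mem)
qed

lemma unit_pole_not_in_K:
  assumes L: "a \<in> L" "b \<in> L" "c \<in> L" "d \<in> L" and det: "a * d - b * c \<noteq> 0"
    and pole: "c \<noteq> 0" "- d / c \<notin> K"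
  defines "U \<equiv> hypercircle K \<alpha> n (mobius a b c d)"
  shows "\<not> polynomially_parametrizable S n U"
    and "\<not> (\<exists>!B. B \<in> branches_at_infinity UNIV n U)"
    and "\<not> (\<exists>!B. B \<in> branches_at_infinity K n U)"
proof -
  let ?e = "- d / c"
  have e: "?e \<in> L" and abc: "a / c \<in> L" "b / c \<in> L"
    using L by (auto intro: L.mem)
  have U: "U = hypercircle K \<alpha> n (mobius (a / c) (b / c) 1 (- ?e))"
    using mobius_scale[OF pole(1,1), of a b d] pole(1) by (simp add: U_def)
  have nz: "b / c + a / c * ?e \<noteq> 0"
    using det pole(1) by (simp add: field_simps)
  obtain \<beta> where \<beta>: "poly minpoly \<beta> = 0" "conjugate_map \<beta> ?e \<noteq> ?e"
    using conjugate_exists[OF e pole(2)] .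
  show "\<not> polynomially_parametrizable S n U"
    by (rule not_polynomially_parametrizable[OF abc e nz U \<beta>])
  show "\<not> (\<exists>!B. B \<in> branches_at_infinity UNIV n U)"
    by (rule not_ex1_branch[OF abc e nz U \<beta>])
  show "\<not> (\<exists>!B. B \<in> branches_at_infinity K n U)"
    unfolding K.ex1_branch_iff using no_branch_over_K[OF abc e nz U \<beta>] by blast
qed

end

interpretation UNIV_char_0: subfield_char_0 UNIV
  by unfold_locales

lemma line_imp_polynomially_parametrizable:
  "is_line n U \<Longrightarrow> polynomially_parametrizable UNIV n (U :: 'f::field_char_0 vec set)"
  unfolding is_line_def using UNIV_char_0.line_polynomially_parametrizable by blast

lemma power_basis_adjoin:
  assumes "is_algebraic_closure_of K" "has_degree K (adjoin K \<alpha>) n"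
  shows "power_basis K (adjoin K \<alpha>) \<alpha> n"
proof -
  have K: "subfield K ring_of_type_algebra" and alg: "\<And>x. ring.algebraic ring_of_type_algebra K x"
    using assms(1) by (auto simp: is_algebraic_closure_of_def)
  note basis = dimension_power_basis[OF K alg assms(2)]
  interpret K: subfield_of_type K by (rule subfield_imp_subfield_of_type[OF K])
  interpret L: subfield_of_type "adjoin K \<alpha>" by (rule subfield_imp_subfield_of_type[OF basis(1)])
  show ?thesis
  proof
    show "\<alpha> \<in> adjoin K \<alpha>"
      by (auto simp: adjoin_def intro: generate_field.incl)
    show "adjoin K \<alpha> = {poly p \<alpha> |p. p \<in> polys_over K \<and> (p = 0 \<or> Polynomial.degree p < n)}"
      by (fact basis(2))
    show "p = 0" if "p \<in> polys_over K" "Polynomial.degree p < n" "poly p \<alpha> = 0" for p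
      using basis(3) that .
    show "\<exists>p\<in>polys_over K. p \<noteq> 0 \<and> poly p x = 0" for x
      using algebraic_imp_poly_root[OF K alg] by metis
  qed
qed

theorem theorem2p6:
  fixes K :: "'f::{alg_closed_field, field_char_0} set"
    and L :: "'f set" and \<alpha> :: 'f and n :: nat
    and u :: "'f poly fract" and U :: "'f vec set"
  assumes "is_algebraic_closure_of K"
    and "L = adjoin K \<alpha>"
    and "has_degree K L n"
    and "is_unit_over L u"
    and "U = hypercircle K \<alpha> n u"
  shows
    "(is_line n U \<longleftrightarrow> (\<exists>v. is_polynomial_unit_over L v \<and> hypercircle K \<alpha> n v = U)) \<and>
     (is_line n U \<longleftrightarrow>
        (\<forall>a\<in>L. \<forall>b\<in>L. \<forall>c\<in>L. \<forall>d\<in>L.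
           a * d - b * c \<noteq> 0 \<and> c \<noteq> 0 \<and> hypercircle K \<alpha> n (mobius a b c d) = U \<longrightarrow>
           (\<forall>t. poly [:d, c:] t = 0 \<longrightarrow> t \<in> K))) \<and>
     (is_line n U \<longleftrightarrow> polynomially_parametrizable UNIV n U) \<and>
     (is_line n U \<longleftrightarrow> (\<exists>!B. B \<in> branches_at_infinity UNIV n U)) \<and>
     (is_line n U \<longleftrightarrow> polynomially_parametrizable K n U) \<and>
     (is_line n U \<longleftrightarrow> (\<exists>!B. B \<in> branches_at_infinity K n U))"
proof -
  interpret power_basis K L \<alpha> n
    unfolding assms(2) using power_basis_adjoin assms(1-3) by blast
  interpret K_char_0: subfield_char_0 K ..
  obtain a b c d where L: "a \<in> L" "b \<in> L" "c \<in> L" "d \<in> L" and det: "a * d - b * c \<noteq> 0"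
    and u: "u = mobius a b c d"
    using assms(4) unfolding is_unit_over_def by blast
  have U: "U = hypercircle K \<alpha> n (mobius a b c d)"
    by (simp add: assms(5) u)
  show ?thesis
  proof (cases "c = 0 \<or> - d / c \<in> K")
    case True
    obtain a' b' where unit: "a' \<in> L" "b' \<in> L" "a' \<noteq> 0" "U = hypercircle K \<alpha> n (Fract [:b', a':] 1)"
      unfolding U by (rule unit_pole_in_K[OF L det True]) blast
    obtain p v where pv: "v \<in> carrier_vec n" "p \<in> carrier_vec n" "v \<noteq> 0\<^sub>v n"
      "\<And>i. i < n \<Longrightarrow> v $ i \<in> K" "\<And>i. i < n \<Longrightarrow> p $ i \<in> K" "U = {p + s \<cdot>\<^sub>v v | s. True}"
      unfolding unit(4) by (rule polynomial_unit_line[OF unit(1-3)]) blast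
    have line: "is_line n U"
      unfolding is_line_def using pv by blast
    have polynomial: "polynomially_parametrizable UNIV n U"
      by (rule line_imp_polynomially_parametrizable[OF line])
    have polynomial_K: "polynomially_parametrizable K n U"
      unfolding pv(6) by (rule K_char_0.line_polynomially_parametrizable[OF pv(1-5)])
    have branch: "\<exists>!B. B \<in> branches_at_infinity UNIV n U"
      unfolding pv(6) by (rule UNIV_char_0.line_ex1_branch[OF pv(1-3)]) simp_all
    have branch_K: "\<exists>!B. B \<in> branches_at_infinity K n U"
      unfolding pv(6) by (rule K_char_0.line_ex1_branch[OF pv(1-5)])
    have unit_U: "\<exists>v. is_polynomial_unit_over L v \<and> hypercircle K \<alpha> n v = U"
      unfolding is_polynomial_unit_over_def using unit by blast
    have poles: "\<forall>a\<in>L. \<forall>b\<in>L. \<forall>c\<in>L. \<forall>d\<in>L.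
        a * d - b * c \<noteq> 0 \<and> c \<noteq> 0 \<and> hypercircle K \<alpha> n (mobius a b c d) = U \<longrightarrow>
        (\<forall>t. poly [:d, c:] t = 0 \<longrightarrow> t \<in> K)"
    proof (intro ballI impI allI)
      fix a b c d t
      assume *: "a \<in> L" "b \<in> L" "c \<in> L" "d \<in> L" "poly [:d, c:] t = 0"
        and **: "a * d - b * c \<noteq> 0 \<and> c \<noteq> 0 \<and> hypercircle K \<alpha> n (mobius a b c d) = U"
      then have "- d / c \<in> K"
        using unit_pole_not_in_K(1)[of a b c d UNIV] polynomial by blast
      moreover have "t = - d / c"
        using *(5) ** by (simp add: field_simps eq_neg_iff_add_eq_0)
      ultimately show "t \<in> K" by simp
    qed
    show ?thesis
      by (intro conjI iffI; (rule line | rule unit_U | rule poles | rule polynomial | rule branch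
          | rule polynomial_K | rule branch_K))
  next
    case False
    then have c: "c \<noteq> 0" "- d / c \<notin> K" by auto
    note negative = unit_pole_not_in_K[OF L det c, folded U]
    have not_line: "\<not> is_line n U"
      using negative(1) line_imp_polynomially_parametrizable by blast
    have no_unit: "\<nexists>v. is_polynomial_unit_over L v \<and> hypercircle K \<alpha> n v = U"
    proof clarify
      fix v assume "is_polynomial_unit_over L v" "U = hypercircle K \<alpha> n v"
      then obtain a' b' where unit: "a' \<in> L" "b' \<in> L" "a' \<noteq> 0" "U = hypercircle K \<alpha> n (Fract [:b', a':] 1)"
        unfolding is_polynomial_unit_over_def by blast
      have "is_line n U"
        unfolding is_line_def unit(4) by (rule polynomial_unit_line[OF unit(1-3)]) blast
      with not_line show False by blast
    qed
    have "poly [:d, c:] (- d / c) = 0"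
      using c by simp
    then have pole: "\<not> (\<forall>a\<in>L. \<forall>b\<in>L. \<forall>c\<in>L. \<forall>d\<in>L.
        a * d - b * c \<noteq> 0 \<and> c \<noteq> 0 \<and> hypercircle K \<alpha> n (mobius a b c d) = U \<longrightarrow>
        (\<forall>t. poly [:d, c:] t = 0 \<longrightarrow> t \<in> K))"
      using L det c U by metis
    show ?thesis
      by (intro conjI iffI; (erule notE[OF not_line] | erule notE[OF no_unit] | erule notE[OF pole]
          | erule notE[OF negative(1)] | erule notE[OF negative(2)] | erule notE[OF negative(3)]))
  qed
qed

end
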